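(* Let $V\in C^\infty(\mathbb R;\mathbb R)$ be even, $V(-x)=V(x)$ for all $x$, and suppose $V=V_{\rm per}+V_{\rm def}$ where $V_{\rm per}(x+1)=V_{\rm per}(x)$ for all $x\in\mathbb R$ and $V_{\rm def}(x)=0$ for $|x|>\rho$, for some $\rho>0$. Suppose $H=-\partial_x^2+V$ on $L^2(\mathbb R)$ has a bound state $\Phi\in L^2(\mathbb R)$, $\Phi\neq 0$, $H\Phi=E\Phi$, with $E>0$. For $M>\rho$ let $\Theta(z)=\Theta_M(z)$ be the function defined in the context. Then there exist $k>0$ and $M_0>\rho$ such that for all $M\ge M_0$: (1) $\Theta$ has a unique root $z^*$ in the ball $\Omega_M=\{z\in\mathbb C: |z-E|\le \frac{1}{M^2}e^{-kM}\}$; (2) $$z^*=E-\frac{\Theta(E)}{\partial_z\Theta(E)}+O(e^{-4kM}).$$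
   Context: Because $V$ is even and $E$ is a non-degenerate eigenvalue, $\Phi$ is either even or odd. For $z\in\mathbb C$, let $u_z(x)$, $x\in[0,M]$, be the solution of $-u_z''+V(x)u_z-zu_z=0$ with initial data $u_z(0)=1,\ u_z'(0)=0$ if $\Phi$ is even, and $u_z(0)=0,\ u_z'(0)=1$ if $\Phi$ is odd (prime denotes $\partial_x$). Define $$\Theta(z):=u_z'(M)-i\sqrt z\,u_z(M),\qquad z\in\mathbb C\setminus(-\infty,0],$$ with the branch of the square root such that $\pm\operatorname{Im}z>0\Rightarrow\pm\operatorname{Im}\sqrt z>0$ (and $\sqrt z>0$ for $z>0$). The notation $O(e^{-4kM})$ means a quantity bounded in modulus by $Ce^{-4kM}$ with $C$ independent of $M\ge M_0$. *)

theory Defs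
  imports "HOL-Analysis.Analysis"
begin

definition smooth :: "(real \<Rightarrow> real) \<Rightarrow> bool" where
  "smooth f \<longleftrightarrow> (\<forall>n x. (deriv ^^ n) f differentiable (at x))"

definition even_fun :: "(real \<Rightarrow> 'a) \<Rightarrow> bool" where
  "even_fun f \<longleftrightarrow> (\<forall>x. f (- x) = f x)"

definition square_integrable :: "(real \<Rightarrow> complex) \<Rightarrow> bool" where
  "square_integrable f \<longleftrightarrow>
     f \<in> borel_measurable lborel \<and> integrable lborel (\<lambda>x. (cmod (f x))\<^sup>2)"

(* f is locally absolutely continuous and g is its derivative almost everywhere. *)
definition has_ac_derivative :: "(real \<Rightarrow> complex) \<Rightarrow> (real \<Rightarrow> complex) \<Rightarrow> bool" where
  "has_ac_derivative f g \<longleftrightarrow>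
     (\<forall>a b. a \<le> b \<longrightarrow>
        set_integrable lborel {a..b} g \<and> f b - f a = (LINT x:{a..b}|lborel. g x))"

(* The graph of H = -d^2/dx^2 + V in L^2(R), on its usual (maximal) domain
     {f in L^2. f and f' locally absolutely continuous, -f'' + V f in L^2},
   which is H^2(R) for bounded V.  An element of the domain is represented by its continuous
   representative f, the image by any function h in the almost-everywhere class of H f. *)
definition schroedinger :: "(real \<Rightarrow> real) \<Rightarrow> (real \<Rightarrow> complex) \<Rightarrow> (real \<Rightarrow> complex) \<Rightarrow> bool" where
  "schroedinger V f h \<longleftrightarrow>
     square_integrable f \<and> square_integrable h \<and>
     (\<exists>f' f''. has_ac_derivative f f' \<and> has_ac_derivative f' f'' \<and>
        (AE x in lborel. h x = - f'' x + complex_of_real (V x) * f x))"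

(* Since \<Phi> is continuous, \<Phi> being nonzero somewhere is the same as \<Phi> being nonzero in L^2(R). *)
definition bound_state :: "(real \<Rightarrow> real) \<Rightarrow> real \<Rightarrow> (real \<Rightarrow> complex) \<Rightarrow> bool" where
  "bound_state V E \<Phi> \<longleftrightarrow>
     (\<exists>x. \<Phi> x \<noteq> 0) \<and> schroedinger V \<Phi> (\<lambda>x. complex_of_real E * \<Phi> x)"

(* u solves -u'' + V u - z u = 0 on [0,M] (one-sided derivatives at the end points) with
   derivative u'.  A bound state of an even potential is either even or odd, so the second
   branch of the initial condition is the odd case. *)
definition solves_ivp ::
  "(real \<Rightarrow> real) \<Rightarrow> (real \<Rightarrow> complex) \<Rightarrow> real \<Rightarrow> complex \<Rightarrow> (real \<Rightarrow> complex) \<Rightarrow> (real \<Rightarrow> complex) \<Rightarrow> bool"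
where
  "solves_ivp V \<Phi> M z u u' \<longleftrightarrow>
     (\<exists>u''. \<forall>x\<in>{0..M}.
        (u has_vector_derivative u' x) (at x within {0..M}) \<and>
        (u' has_vector_derivative u'' x) (at x within {0..M}) \<and>
        - u'' x + complex_of_real (V x) * u x - z * u x = 0) \<and>
     (if even_fun \<Phi> then u 0 = 1 \<and> u' 0 = 0 else u 0 = 0 \<and> u' 0 = 1)"

(* The pair (u_z, u_z'), which is unique on [0,M] only; values elsewhere are irrelevant. *)
definition ivp_solution ::
  "(real \<Rightarrow> real) \<Rightarrow> (real \<Rightarrow> complex) \<Rightarrow> real \<Rightarrow> complex \<Rightarrow> (real \<Rightarrow> complex) \<times> (real \<Rightarrow> complex)"
where
  "ivp_solution V \<Phi> M z = (SOME (u, u'). solves_ivp V \<Phi> M z u u')"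

(* On the slit plane csqrt is the branch with +-Im z > 0 implying +-Im (csqrt z) > 0 and
   csqrt z > 0 for z > 0. *)
definition Theta :: "(real \<Rightarrow> real) \<Rightarrow> (real \<Rightarrow> complex) \<Rightarrow> real \<Rightarrow> complex \<Rightarrow> complex" where
  "Theta V \<Phi> M z = (case ivp_solution V \<Phi> M z of (u, u') \<Rightarrow> u' M - \<i> * csqrt z * u M)"

definition Theta_dom :: "complex set" where
  "Theta_dom = - \<real>\<^sub>\<le>\<^sub>0"

definition Omega :: "real \<Rightarrow> real \<Rightarrow> real \<Rightarrow> complex set" where
  "Omega E k M = {z. cmod (z - complex_of_real E) \<le> 1 / M\<^sup>2 * exp (- k * M)}"

definition Theta_root ::
  "(real \<Rightarrow> real) \<Rightarrow> (real \<Rightarrow> complex) \<Rightarrow> real \<Rightarrow> real \<Rightarrow> real \<Rightarrow> complex \<Rightarrow> bool" where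
  "Theta_root V \<Phi> E k M z \<longleftrightarrow> z \<in> Omega E k M \<and> z \<in> Theta_dom \<and> Theta V \<Phi> M z = 0"

end

theory Submission
  imports Defs "HOL-Real_Asymp.Real_Asymp"
begin

text \<open>
  Let \<open>u\<close> be the real solution of the initial value problem at \<open>z = E\<close>. It is square integrable on
  \<open>[0, \<infinity>)\<close>, so its Wronskian with its unit translate vanishes; hence \<open>u (x + 1) = \<mu> u x\<close> outside the
  defect with \<open>\<bar>\<mu>\<bar> < 1\<close>, and \<open>u\<close> decays exactly like \<open>e\<^sup>-\<^sup>\<kappa>\<^sup>x\<close> while the complementary solution grows at
  most like \<open>e\<^sup>\<kappa>\<^sup>x\<close>. Solving by variation of constants, the solution at \<open>z\<close> is a power series in
  \<open>z - E\<close> whose coefficients are \<open>O(e\<^sup>\<kappa>\<^sup>x (C x)\<^sup>n / n!)\<close>. Thus \<open>\<Theta>(E) = O(e\<^sup>-\<^sup>\<kappa>\<^sup>M)\<close>, and near \<open>E\<close> the derivative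
  \<open>\<Theta>'\<close> has Lipschitz constant \<open>O(M\<^sup>2 e\<^sup>\<kappa>\<^sup>M)\<close>. The Wronskian of \<open>u\<close> and \<open>\<partial>\<^sub>z u\<close> at \<open>M\<close> is
  \<open>- \<integral>\<^sub>0\<^sup>M u\<^sup>2\<close>, which forces \<open>\<bar>\<Theta>'(E)\<bar> \<ge> c e\<^sup>\<kappa>\<^sup>M\<close>. So the simplified Newton map \<open>z - \<Theta>(z) / \<Theta>'(E)\<close> contracts
  \<open>\<Omega>\<^sub>M\<close> into itself for \<open>k = \<kappa> / 2\<close>, and its fixed point differs from the first Newton step by
  \<open>O(M\<^sup>2 e\<^sup>-\<^sup>4\<^sup>\<kappa>\<^sup>M)\<close>.
\<close>

section \<open>Energy estimates\<close>

text \<open>By Cauchy-Schwarz and 2ab <= a^2 + b^2 the derivative of \<open>R\<close> is at most (1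
  + K) R in absolute value, so R exp((1 + K) x) increases and R exp(-(1 + K) x) decreases. Values in
  a real inner product space cover real and complex solutions at once.\<close>

lemma energy_growth:
  fixes u u' u'' :: "real \<Rightarrow> 'a::real_inner"
  assumes u: "\<And>x. x \<in> {a..b} \<Longrightarrow> (u has_vector_derivative u' x) (at x within {a..b})"
    and u': "\<And>x. x \<in> {a..b} \<Longrightarrow> (u' has_vector_derivative u'' x) (at x within {a..b})"
    and K: "\<And>x. x \<in> {a..b} \<Longrightarrow> norm (u'' x) \<le> K * norm (u x)"
    and "a \<le> b" "0 \<le> K"
  defines "R \<equiv> \<lambda>x. (norm (u x))\<^sup>2 + (norm (u' x))\<^sup>2"
  shows "R b \<le> exp ((1 + K) * (b - a)) * R a" "R a \<le> exp ((1 + K) * (b - a)) * R b"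
proof -
  define R' where "R' x = 2 * (u x \<bullet> u' x) + 2 * (u' x \<bullet> u'' x)" for x
  have R_eq: "R = (\<lambda>x. u x \<bullet> u x + u' x \<bullet> u' x)"
    by (simp add: R_def power2_norm_eq_inner)
  have R': "(R has_real_derivative R' x) (at x within {a..b})" if "x \<in> {a..b}" for x
    unfolding R_eq has_field_derivative_def
    by (rule derivative_eq_intros u[OF that, unfolded has_vector_derivative_def]
          u'[OF that, unfolded has_vector_derivative_def] refl)+
       (auto simp: R'_def algebra_simps inner_commute)
  have R'_le: "\<bar>R' x\<bar> \<le> (1 + K) * R x" if "x \<in> {a..b}" for x
  proof -
    have "\<bar>R' x\<bar> \<le> 2 * \<bar>u x \<bullet> u' x\<bar> + 2 * \<bar>u' x \<bullet> u'' x\<bar>"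
      unfolding R'_def by linarith
    also have "\<dots> \<le> 2 * (norm (u x) * norm (u' x)) + 2 * (norm (u' x) * (K * norm (u x)))"
      by (intro add_mono mult_left_mono order_trans[OF Cauchy_Schwarz_ineq2] K that) auto
    also have "\<dots> = (1 + K) * (2 * norm (u x) * norm (u' x))"
      by (simp add: algebra_simps)
    also have "\<dots> \<le> (1 + K) * R x"
      unfolding R_def using sum_squares_bound[of "norm (u x)" "norm (u' x)"] \<open>0 \<le> K\<close>
      by (intro mult_left_mono) auto
    finally show ?thesis .
  qed
  have mono: "exp (c * a) * R a \<le> exp (c * b) * R b" if "c = 1 + K" for c
  proof (rule DERIV_nonneg_imp_increasing_open[OF \<open>a \<le> b\<close>])
    show "continuous_on {a..b} (\<lambda>x. exp (c * x) * R x)"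
      by (intro continuous_intros DERIV_continuous_on[OF R'])
    fix x assume x: "a < x" "x < b"
    have "(R has_real_derivative R' x) (at x)"
      using R'[of x] x by (simp add: at_within_Icc_at)
    hence "((\<lambda>x. exp (c * x) * R x) has_real_derivative exp (c * x) * (R' x + c * R x)) (at x)"
      by (auto intro!: derivative_eq_intros simp: algebra_simps)
    moreover have "R' x + c * R x \<ge> 0" using R'_le[of x] x that by auto
    ultimately show "\<exists>y. ((\<lambda>x. exp (c * x) * R x) has_real_derivative y) (at x) \<and> y \<ge> 0"
      by fastforce
  qed
  have anti: "exp (c * b) * R b \<le> exp (c * a) * R a" if "c = - (1 + K)" for c
  proof (rule DERIV_nonpos_imp_decreasing_open[OF \<open>a \<le> b\<close>])
    show "continuous_on {a..b} (\<lambda>x. exp (c * x) * R x)"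
      by (intro continuous_intros DERIV_continuous_on[OF R'])
    fix x assume x: "a < x" "x < b"
    have "(R has_real_derivative R' x) (at x)"
      using R'[of x] x by (simp add: at_within_Icc_at)
    hence "((\<lambda>x. exp (c * x) * R x) has_real_derivative exp (c * x) * (R' x + c * R x)) (at x)"
      by (auto intro!: derivative_eq_intros simp: algebra_simps)
    moreover have "R' x + c * R x \<le> 0" using R'_le[of x] x unfolding that by (auto simp: algebra_simps)
    ultimately show "\<exists>y. ((\<lambda>x. exp (c * x) * R x) has_real_derivative y) (at x) \<and> y \<le> 0"
      by (metis exp_ge_zero mult_nonneg_nonpos)
  qed
  show "R b \<le> exp ((1 + K) * (b - a)) * R a"
  proof -
    have "R b = exp ((1 + K) * b) * (exp (- (1 + K) * b) * R b)"
      by (simp add: mult_exp_exp algebra_simps flip: mult.assoc)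
    also have "\<dots> \<le> exp ((1 + K) * b) * (exp (- (1 + K) * a) * R a)"
      using anti by (intro mult_left_mono) auto
    also have "\<dots> = exp ((1 + K) * (b - a)) * R a"
      by (simp add: mult_exp_exp algebra_simps flip: mult.assoc)
    finally show ?thesis .
  qed
  show "R a \<le> exp ((1 + K) * (b - a)) * R b"
  proof -
    have "R a = exp (- (1 + K) * a) * (exp ((1 + K) * a) * R a)"
      by (simp add: mult_exp_exp algebra_simps flip: mult.assoc)
    also have "\<dots> \<le> exp (- (1 + K) * a) * (exp ((1 + K) * b) * R b)"
      using mono by (intro mult_left_mono) auto
    also have "\<dots> = exp ((1 + K) * (b - a)) * R b"
      by (simp add: mult_exp_exp algebra_simps flip: mult.assoc)
    finally show ?thesis .
  qed
qed

text \<open>Uniqueness for the linear equation: the energy vanishes at \<open>x0\<close>, and the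
  two directions of the growth estimate carry this to the right and to the left of
  \<open>x0\<close>.\<close>

lemma ode_zero:
  fixes u u' u'' :: "real \<Rightarrow> 'a::real_inner"
  assumes u: "\<And>x. x \<in> {a..b} \<Longrightarrow> (u has_vector_derivative u' x) (at x within {a..b})"
    and u': "\<And>x. x \<in> {a..b} \<Longrightarrow> (u' has_vector_derivative u'' x) (at x within {a..b})"
    and K: "\<And>x. x \<in> {a..b} \<Longrightarrow> norm (u'' x) \<le> K * norm (u x)" "0 \<le> K"
    and x0: "x0 \<in> {a..b}" "u x0 = 0" "u' x0 = 0"
    and x: "x \<in> {a..b}"
  shows "u x = 0 \<and> u' x = 0"
proof -
  define R where "R = (\<lambda>x. (norm (u x))\<^sup>2 + (norm (u' x))\<^sup>2)"
  have sub: "(u has_vector_derivative u' t) (at t within {c..d})"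
    "(u' has_vector_derivative u'' t) (at t within {c..d})"
    if "t \<in> {c..d}" "c \<in> {a..b}" "d \<in> {a..b}" for c d t
    using that by (intro has_vector_derivative_within_subset[OF u] 
        has_vector_derivative_within_subset[OF u']; auto)+
  have "R x \<le> exp ((1 + K) * \<bar>x - x0\<bar>) * R x0"
  proof (cases "x0 \<le> x")
    case True
    have "R x \<le> exp ((1 + K) * (x - x0)) * R x0"
      unfolding R_def
      using x x0 True by (intro energy_growth(1)[OF sub(1) sub(2)] K) auto
    thus ?thesis using True by simp
  next
    case False
    have "R x \<le> exp ((1 + K) * (x0 - x)) * R x0"
      unfolding R_def
      using x x0 False by (intro energy_growth(2)[OF sub(1) sub(2)] K) auto
    thus ?thesis using False by simp
  qed
  also have "R x0 = 0" using x0 by (simp add: R_def)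
  finally show ?thesis unfolding R_def
    by (simp add: add_nonneg_eq_0_iff sum_power2_le_zero_iff)
qed

section \<open>Exponential decay of square integrable solutions\<close>

text \<open>Carries a property from one period to the whole half line, by induction on the number of
  unit intervals.\<close>

lemma ge_unit_step_induct:
  fixes a x :: real
  assumes base: "\<And>y. a \<le> y \<Longrightarrow> y \<le> a + 1 \<Longrightarrow> P y"
    and step: "\<And>y. a \<le> y \<Longrightarrow> P y \<Longrightarrow> P (y + 1)"
    and "a \<le> x"
  shows "P x"
proof -
  have "P y" if "a \<le> y" "y \<le> a + 1 + real n" for n y
    using that
  proof (induction n arbitrary: y)
    case 0
    thus ?case using base by simp
  next
    case (Suc n)
    show ?case
    proof (cases "y \<le> a + 1")
      case True
      thus ?thesis using base Suc by simp
    next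
      case False
      hence "P (y - 1)" using Suc by auto
      thus ?thesis using step[of "y - 1"] False by simp
    qed
  qed
  moreover obtain n where "x - a - 1 \<le> real n"
    using real_arch_simple by blast
  ultimately show ?thesis using \<open>a \<le> x\<close> by (simp add: algebra_simps)
qed

locale ode_solution =
  fixes q u u' :: "real \<Rightarrow> real"
  assumes cont_q: "continuous_on UNIV q"
    and deriv_u: "\<And>x. (u has_real_derivative u' x) (at x)"
    and deriv_u': "\<And>x. (u' has_real_derivative q x * u x) (at x)"
    and nontrivial: "u 0 \<noteq> 0 \<or> u' 0 \<noteq> 0"
begin

definition energy :: "real \<Rightarrow> real" where
  "energy x = (u x)\<^sup>2 + (u' x)\<^sup>2"

lemma cont_u: "continuous_on A u" and cont_u': "continuous_on A u'"
  by (rule DERIV_continuous_on, rule DERIV_subset, rule deriv_u deriv_u', simp)+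

lemma cont_energy: "continuous_on A energy"
  unfolding energy_def by (intro continuous_intros cont_u cont_u')

text \<open>Zero energy at x means zero Cauchy data there; uniqueness transports it to 0, against
  \<open>nontrivial\<close>.\<close>

lemma energy_pos: "energy x > 0"
proof (rule ccontr)
  assume "\<not> energy x > 0"
  hence zero: "u x = 0" "u' x = 0"
    by (auto simp: energy_def not_less sum_power2_le_zero_iff)
  define a b where "a = min x 0" and "b = max x 0"
  have "compact (q ` {a..b})"
    by (intro compact_continuous_image continuous_on_subset[OF cont_q]) auto
  then obtain K where K: "\<And>y. y \<in> {a..b} \<Longrightarrow> \<bar>q y\<bar> \<le> K"
    by (fastforce dest!: compact_imp_bounded simp: bounded_iff)
  have "0 \<le> K" using K[of x] by (auto simp: a_def b_def)
  have "u 0 = 0 \<and> u' 0 = 0"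
  proof (rule ode_zero[where a = a and b = b and u = u and u' = u' and x = 0 and u'' = "\<lambda>x. q x * u x" and K = K and ?x0.0 = x])
    fix y assume "y \<in> {a..b}"
    show "(u has_vector_derivative u' y) (at y within {a..b})"
      "(u' has_vector_derivative q y * u y) (at y within {a..b})"
      using deriv_u deriv_u'
      by (auto simp flip: has_real_derivative_iff_has_vector_derivative intro: DERIV_subset)
    show "norm (q y * u y) \<le> K * norm (u y)"
      using K[OF \<open>y \<in> {a..b}\<close>] by (auto simp: abs_mult intro: mult_right_mono)
  qed (use zero \<open>0 \<le> K\<close> in \<open>auto simp: a_def b_def\<close>)
  thus False using nontrivial by auto
qed

text \<open>If the energy stayed above \<open>c > 0\<close>, then \<open>(u u')' = u'\<^sup>2 + q u\<^sup>2\<close> would force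
  \<open>u u'\<close>, hence \<open>u\<^sup>2\<close>, to grow at least linearly.\<close>

lemma energy_not_bounded_below:
  assumes K: "\<And>x. x \<ge> a \<Longrightarrow> \<bar>q x\<bar> \<le> K"
    and S: "\<And>x. x \<ge> a \<Longrightarrow> (S has_real_derivative (u x)\<^sup>2) (at x)"
    and B: "\<And>x. x \<ge> a \<Longrightarrow> S x \<le> B"
    and "c > 0"
  shows "\<exists>x\<ge>a. energy x < c"
proof (rule ccontr)
  assume "\<not> ?thesis"
  hence c: "\<And>x. x \<ge> a \<Longrightarrow> c \<le> energy x" by (auto simp: not_less)
  have "K \<ge> 0" using K[of a] by simp
  \<comment> \<open>Since q >= -K, the derivative u'^2 + (q + 1 + K) u^2 of \<open>g\<close> is at
    least the energy, hence at least c. As S stays below B, linear growth of g must come from u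
    u'.\<close>
  define g where "g x = u x * u' x + (1 + K) * S x" for x
  have g: "g x \<ge> g a + c * (x - a)" if "x \<ge> a" for x
  proof -
    have "g a - c * a \<le> g x - c * x"
    proof (rule DERIV_nonneg_imp_nondecreasing[OF that], intro exI conjI)
      fix y assume y: "a \<le> y"
      show "((\<lambda>x. g x - c * x) has_real_derivative
          ((u' y)\<^sup>2 + q y * (u y)\<^sup>2 + (1 + K) * (u y)\<^sup>2 - c)) (at y)"
        unfolding g_def
        by (auto intro!: derivative_eq_intros deriv_u deriv_u' S y simp: power2_eq_square algebra_simps)
      have "- K * (u y)\<^sup>2 \<le> q y * (u y)\<^sup>2"
        using K[OF y] by (intro mult_right_mono) auto
      thus "(u' y)\<^sup>2 + q y * (u y)\<^sup>2 + (1 + K) * (u y)\<^sup>2 - c \<ge> 0"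
        using c[OF y] by (simp add: energy_def algebra_simps)
    qed
    thus ?thesis by (simp add: algebra_simps)
  qed
  \<comment> \<open>By the point \<open>b\<close> the growth c (b - a) has absorbed the initial
    value of g and the contribution of S, with 1 to spare.\<close>
  define b where "b = a + (\<bar>g a\<bar> + (1 + K) * \<bar>B\<bar> + 1) / c"
  have "b \<ge> a" using \<open>c > 0\<close> \<open>K \<ge> 0\<close> by (simp add: b_def)
  have uu': "u x * u' x \<ge> 1" if "x \<ge> b" for x
  proof -
    have "\<bar>g a\<bar> + (1 + K) * \<bar>B\<bar> + 1 = c * (b - a)"
      using \<open>c > 0\<close> by (simp add: b_def)
    also have "\<dots> \<le> c * (x - a)" using that \<open>c > 0\<close> by simp
    also have "\<dots> \<le> g x - g a" using g[of x] that \<open>b \<ge> a\<close> by simp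
    also have "g x \<le> u x * u' x + (1 + K) * \<bar>B\<bar>"
      unfolding g_def using B[of x] that \<open>b \<ge> a\<close> \<open>K \<ge> 0\<close> by (intro add_left_mono mult_left_mono) auto
    finally show ?thesis by linarith
  qed
  have usq: "(u x)\<^sup>2 \<ge> x - b" if "x \<ge> b" for x
  proof -
    have "(u b)\<^sup>2 - b \<le> (u x)\<^sup>2 - x"
    proof (rule DERIV_nonneg_imp_nondecreasing[OF that], intro exI conjI)
      fix y assume "b \<le> y"
      show "((\<lambda>x. (u x)\<^sup>2 - x) has_real_derivative 2 * (u y * u' y) - 1) (at y)"
        by (auto intro!: derivative_eq_intros deriv_u)
      show "2 * (u y * u' y) - 1 \<ge> 0" using uu'[OF \<open>b \<le> y\<close>] by simp
    qed
    thus ?thesis by (smt (verit) zero_le_power2)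
  qed
  \<comment> \<open>Beyond b, S grows at least like (x - b)^2 / 2. The summand 2 makes this at least
    x - b, which exceeds |B| + |S b|, so S passes its bound at \<open>x\<close>.\<close>
  define x where "x = b + (\<bar>B\<bar> + \<bar>S b\<bar> + 2)"
  have "b \<le> x" by (simp add: x_def)
  have "S b - (b - b)\<^sup>2 / 2 \<le> S x - (x - b)\<^sup>2 / 2"
  proof (rule DERIV_nonneg_imp_nondecreasing[OF \<open>b \<le> x\<close>], intro exI conjI)
    fix y assume "b \<le> y"
    show "((\<lambda>x. S x - (x - b)\<^sup>2 / 2) has_real_derivative (u y)\<^sup>2 - (y - b)) (at y)"
      using \<open>b \<le> y\<close> \<open>a \<le> b\<close> by (auto intro!: derivative_eq_intros S simp: field_simps)
    show "(u y)\<^sup>2 - (y - b) \<ge> 0" using usq[OF \<open>b \<le> y\<close>] by simp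
  qed
  hence "S b \<le> S x - (x - b)\<^sup>2 / 2" by simp
  also have "2 * (x - b) \<le> (x - b)\<^sup>2"
    unfolding power2_eq_square by (intro mult_right_mono) (auto simp: x_def)
  hence "S x - (x - b)\<^sup>2 / 2 \<le> S x - (x - b)" by simp
  finally have "S b + (x - b) \<le> S x" by simp
  moreover have "S x \<le> B" "x - b = \<bar>B\<bar> + \<bar>S b\<bar> + 2"
    using B[of x] \<open>b \<le> x\<close> \<open>a \<le> b\<close> by (auto simp: x_def)
  ultimately show False
    using abs_ge_self[of B] abs_ge_minus_self[of "S b"] by linarith
qed

end

text \<open>Square integrability of u on the half line is encoded by an antiderivative
  \<open>S\<close> of u^2 that is bounded above. The coefficient is periodic only from
  \<open>a\<close> on, beyond the defect.\<close>

locale square_integrable_solution = ode_solution +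
  fixes a K B :: real and S :: "real \<Rightarrow> real"
  assumes a_nonneg: "a \<ge> 0"
    and periodic: "\<And>x. x \<ge> a \<Longrightarrow> q (x + 1) = q x"
    and q_bound: "\<And>x. x \<ge> 0 \<Longrightarrow> \<bar>q x\<bar> \<le> K"
    and S: "\<And>x. x \<ge> 0 \<Longrightarrow> (S has_real_derivative (u x)\<^sup>2) (at x)"
    and S_bound: "\<And>x. x \<ge> 0 \<Longrightarrow> S x \<le> B"
begin

lemma K_nonneg: "K \<ge> 0"
  using q_bound[of 0] by simp

lemma deriv_shift:
  shows "((\<lambda>x. u (x + 1)) has_real_derivative u' (x + 1)) (at x)"
    and "((\<lambda>x. u' (x + 1)) has_real_derivative q (x + 1) * u (x + 1)) (at x)"
  using deriv_u[of "x + 1"] deriv_u'[of "x + 1"] by (simp_all add: DERIV_shift)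

text \<open>Beyond a the translate of u solves the same equation, so this Wronskian is constant. It
  is bounded by a multiple of the energy, which takes arbitrarily small values because u is square
  integrable.\<close>

lemma shift_wronskian_zero:
  assumes "x \<ge> a"
  shows "u x * u' (x + 1) - u' x * u (x + 1) = 0"
proof -
  define W where "W x = u x * u' (x + 1) - u' x * u (x + 1)" for x
  have "(W has_real_derivative 0) (at x within {a..})" if "x \<in> {a..}" for x
    unfolding W_def using periodic[of x] that
    by (auto intro!: derivative_eq_intros DERIV_subset[OF deriv_u] DERIV_subset[OF deriv_u']
        DERIV_subset[OF deriv_shift(1)] DERIV_subset[OF deriv_shift(2)] simp: algebra_simps)
  then obtain W0 where W0: "\<And>x. x \<ge> a \<Longrightarrow> W x = W0"
    using has_field_derivative_zero_constant[of "{a..}" W] by auto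
  \<comment> \<open>The Wronskian is at most the sum of the energies at x and x + 1, and the energy
    grows by at most the factor exp(1 + K) over a unit step.\<close>
  define L where "L = 1 + exp (1 + K)"
  have "L > 0" by (simp add: L_def add_pos_pos)
  have W_le: "\<bar>W x\<bar> \<le> L * energy x" if "x \<ge> a" for x
  proof -
    have *: "\<bar>W x\<bar> \<le> \<bar>u x\<bar> * \<bar>u' (x + 1)\<bar> + \<bar>u' x\<bar> * \<bar>u (x + 1)\<bar>"
      unfolding W_def by (metis abs_mult abs_triangle_ineq4)
    have am_gm: "s * t \<le> (s\<^sup>2 + t\<^sup>2) / 2" for s t :: real
      using sum_squares_bound[of s t] by simp
    have "\<bar>W x\<bar> \<le> energy x + energy (x + 1)"
      using * am_gm[of "\<bar>u x\<bar>" "\<bar>u' (x + 1)\<bar>"] am_gm[of "\<bar>u' x\<bar>" "\<bar>u (x + 1)\<bar>"]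
        energy_pos[of x] energy_pos[of "x + 1"]
      by (simp add: energy_def)
    also have "energy (x + 1) \<le> exp (1 + K) * energy x"
    proof -
      have "(norm (u (x + 1)))\<^sup>2 + (norm (u' (x + 1)))\<^sup>2
          \<le> exp ((1 + K) * (x + 1 - x)) * ((norm (u x))\<^sup>2 + (norm (u' x))\<^sup>2)"
        using that a_nonneg K_nonneg q_bound
        by (intro energy_growth(1)[where u'' = "\<lambda>x. q x * u x"])
           (auto simp: abs_mult intro!: DERIV_subset[OF deriv_u] DERIV_subset[OF deriv_u'] mult_right_mono
            simp flip: has_real_derivative_iff_has_vector_derivative)
      thus ?thesis by (simp add: energy_def)
    qed
    finally show ?thesis by (simp add: L_def algebra_simps)
  qed
  have "W0 = 0"
  proof (rule ccontr)
    assume "W0 \<noteq> 0"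
    hence "\<exists>x\<ge>a. energy x < \<bar>W0\<bar> / L"
      using a_nonneg q_bound S S_bound \<open>L > 0\<close> by (intro energy_not_bounded_below[of _ K S B]) auto
    then obtain x where "x \<ge> a" "energy x < \<bar>W0\<bar> / L" by blast
    thus False using W_le[of x] W0[of x] \<open>L > 0\<close> by (simp add: field_simps)
  qed
  thus ?thesis using W0[OF assms] by (simp add: W_def)
qed

text \<open>A vanishing Wronskian at a makes the Cauchy data of u and of its translate proportional
  there; uniqueness extends the proportionality to all x >= a.\<close>

lemma floquet_multiplier:
  obtains \<mu> where "\<And>x. x \<ge> a \<Longrightarrow> u (x + 1) = \<mu> * u x" "\<And>x. x \<ge> a \<Longrightarrow> u' (x + 1) = \<mu> * u' x"
proof -
  have "\<exists>\<mu>. u (a + 1) = \<mu> * u a \<and> u' (a + 1) = \<mu> * u' a"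
  proof (cases "u a = 0")
    case True
    hence "u' a \<noteq> 0" using energy_pos[of a] by (auto simp: energy_def)
    thus ?thesis using True shift_wronskian_zero[of a] 
      by (intro exI[of _ "u' (a + 1) / u' a"]) auto
  next
    case False
    thus ?thesis using shift_wronskian_zero[of a] 
      by (intro exI[of _ "u (a + 1) / u a"]) (auto simp: field_simps)
  qed
  then obtain \<mu> where \<mu>: "u (a + 1) = \<mu> * u a" "u' (a + 1) = \<mu> * u' a" by blast
  have "u (x + 1) - \<mu> * u x = 0 \<and> u' (x + 1) - \<mu> * u' x = 0" if "x \<ge> a" for x
  proof (rule ode_zero[where a = a and b = x and x = x
        and u = "\<lambda>y. u (y + 1) - \<mu> * u y" and u' = "\<lambda>y. u' (y + 1) - \<mu> * u' y" and u'' = "\<lambda>y. q y * (u (y + 1) - \<mu> * u y)"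
        and K = K and ?x0.0 = a])
    fix y assume y: "y \<in> {a..x}"
    show "((\<lambda>x. u (x + 1) - \<mu> * u x) has_vector_derivative u' (y + 1) - \<mu> * u' y) (at y within {a..x})"
      unfolding has_real_derivative_iff_has_vector_derivative[symmetric]
      by (auto intro!: derivative_eq_intros DERIV_subset[OF deriv_u] DERIV_subset[OF deriv_shift(1)])
    show "((\<lambda>x. u' (x + 1) - \<mu> * u' x) has_vector_derivative q y * (u (y + 1) - \<mu> * u y)) 
        (at y within {a..x})"
      unfolding has_real_derivative_iff_has_vector_derivative[symmetric] using y periodic[of y]
      by (auto intro!: derivative_eq_intros DERIV_subset[OF deriv_u'] DERIV_subset[OF deriv_shift(2)]
          simp: algebra_simps)
    show "norm (q y * (u (y + 1) - \<mu> * u y)) \<le> K * norm (u (y + 1) - \<mu> * u y)"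
      using q_bound[of y] a_nonneg y by (auto simp: abs_mult intro: mult_right_mono)
  qed (use \<mu> K_nonneg that in auto)
  thus ?thesis by (intro that[of \<mu>]) auto
qed

text \<open>Each period multiplies the energy by \<mu>^2. If |\<mu>| >= 1, the energy would stay
  above its minimum on [a, a + 1]; hence |\<mu>| < 1 and \<kappa> = - ln |\<mu>| is positive. Then
  exp(2 \<kappa> x) times the energy has period 1 beyond a, so its extrema over [0, a + 1] bound it
  for all x >= 0.\<close>

lemma energy_exponential:
  obtains \<kappa> m C where "\<kappa> > 0" "m > 0" "C > 0"
    "\<And>x. x \<ge> 0 \<Longrightarrow> m * exp (- (2 * \<kappa> * x)) \<le> energy x"
    "\<And>x. x \<ge> 0 \<Longrightarrow> energy x \<le> C * exp (- (2 * \<kappa> * x))"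
proof -
  obtain \<mu> where \<mu>: "\<And>x. x \<ge> a \<Longrightarrow> u (x + 1) = \<mu> * u x" "\<And>x. x \<ge> a \<Longrightarrow> u' (x + 1) = \<mu> * u' x"
    using floquet_multiplier by blast
  have step: "energy (x + 1) = \<mu>\<^sup>2 * energy x" if "x \<ge> a" for x
    using \<mu>[OF that] by (simp add: energy_def power_mult_distrib algebra_simps)
  have "\<mu> \<noteq> 0" using step[of a] energy_pos[of "a + 1"] by auto
  obtain x1 where x1: "\<And>x. x \<in> {a..a+1} \<Longrightarrow> energy x1 \<le> energy x"
    using continuous_attains_inf[OF compact_Icc _ cont_energy, of a "a + 1"] by force
  have "\<bar>\<mu>\<bar> < 1"
  proof (rule ccontr)
    assume "\<not> \<bar>\<mu>\<bar> < 1"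
    hence "\<mu>\<^sup>2 \<ge> 1" by (simp add: abs_square_less_1 flip: not_less)
    have "energy x \<ge> energy x1" if "x \<ge> a" for x
      using that
    proof (rule ge_unit_step_induct[rotated 2])
      fix y assume "a \<le> y" "energy x1 \<le> energy y"
      thus "energy x1 \<le> energy (y + 1)"
        using mult_right_mono[OF \<open>\<mu>\<^sup>2 \<ge> 1\<close>, of "energy y"] energy_pos[of y] step[of y] by linarith
    qed (use x1 in auto)
    moreover have "\<exists>x\<ge>a. energy x < energy x1"
      using a_nonneg q_bound S S_bound energy_pos
      by (intro energy_not_bounded_below[of _ K S B]) auto
    ultimately show False by force
  qed
  define \<kappa> where "\<kappa> = - ln \<bar>\<mu>\<bar>"
  have "\<kappa> > 0" using \<open>\<bar>\<mu>\<bar> < 1\<close> \<open>\<mu> \<noteq> 0\<close> by (simp add: \<kappa>_def)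
  have exp2: "exp (2 * \<kappa>) * \<mu>\<^sup>2 = 1"
  proof -
    have "exp (2 * \<kappa>) = (exp \<kappa>)\<^sup>2" by (simp add: exp_double)
    also have "exp \<kappa> = 1 / \<bar>\<mu>\<bar>" using \<open>\<mu> \<noteq> 0\<close> by (simp add: \<kappa>_def exp_minus field_simps)
    finally show ?thesis using \<open>\<mu> \<noteq> 0\<close> by (simp add: power_divide)
  qed
  define h where "h x = exp (2 * \<kappa> * x) * energy x" for x
  have h_step: "h (x + 1) = h x" if "x \<ge> a" for x
  proof -
    have "h (x + 1) = exp (2 * \<kappa> * x) * (exp (2 * \<kappa>) * \<mu>\<^sup>2) * energy x"
      unfolding h_def step[OF that] by (simp add: exp_add algebra_simps)
    thus ?thesis by (simp add: exp2 h_def)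
  qed
  have cont_h: "continuous_on {0..a+1} h"
    unfolding h_def by (intro continuous_intros cont_energy)
  obtain x2 where x2: "\<And>x. x \<in> {0..a+1} \<Longrightarrow> h x2 \<le> h x"
    using continuous_attains_inf[OF compact_Icc _ cont_h] a_nonneg by force
  obtain x3 where x3: "\<And>x. x \<in> {0..a+1} \<Longrightarrow> h x \<le> h x3"
    using continuous_attains_sup[OF compact_Icc _ cont_h] a_nonneg by force
  have h_bounds: "h x2 \<le> h x \<and> h x \<le> h x3" if "x \<ge> 0" for x
  proof (cases "x \<le> a")
    case True
    thus ?thesis using that x2 x3 by simp
  next
    case False
    hence "a \<le> x" by simp
    thus ?thesis
      by (rule ge_unit_step_induct[rotated 2]) (use x2 x3 a_nonneg in \<open>auto simp: h_step\<close>)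
  qed
  show ?thesis
  proof (rule that[of \<kappa> "h x2" "h x3"])
    fix x :: real assume "x \<ge> 0"
    have "energy x = h x * exp (- (2 * \<kappa> * x))"
      by (simp add: h_def exp_minus field_simps)
    thus "h x2 * exp (- (2 * \<kappa> * x)) \<le> energy x" "energy x \<le> h x3 * exp (- (2 * \<kappa> * x))"
      using h_bounds[OF \<open>x \<ge> 0\<close>] by auto
  qed (use \<open>\<kappa> > 0\<close> energy_pos in \<open>auto simp: h_def\<close>)
qed

end

section \<open>The complementary solution\<close>

text \<open>The integral between extended real end points is signed, so this is an antiderivative to
  the left of 0 as well.\<close>

definition primitive :: "(real \<Rightarrow> real) \<Rightarrow> real \<Rightarrow> real" where
  "primitive f x = (LBINT t=ereal 0..ereal x. f t)"

lemma primitive_0 [simp]: "primitive f 0 = 0"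
  by (simp add: primitive_def del: ereal_eq_0)

lemma primitive_deriv:
  assumes "continuous_on UNIV f"
  shows "(primitive f has_real_derivative f x) (at x)"
proof -
  define b where "b = \<bar>x\<bar> + 1"
  have "((\<lambda>x. LBINT t=ereal 0..ereal x. f t) has_vector_derivative f x) (at x within {-b..b})"
    by (intro interval_integral_FTC2 continuous_on_subset[OF assms]) (auto simp: b_def)
  moreover have "x \<in> interior {-b..b}" by (auto simp: b_def)
  ultimately show ?thesis
    unfolding primitive_def[abs_def] has_real_derivative_iff_has_vector_derivative
    by (simp only: at_within_interior)
qed

text \<open>Both G - primitive f and G + primitive f are nondecreasing on [0, x]. Integral estimates
  thus reduce to exhibiting an antiderivative of a majorant.\<close>

lemma primitive_bound:
  assumes f: "continuous_on UNIV f"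
    and G: "\<And>t. 0 \<le> t \<Longrightarrow> t \<le> x \<Longrightarrow> (G has_real_derivative g t) (at t)"
    and le: "\<And>t. 0 \<le> t \<Longrightarrow> t \<le> x \<Longrightarrow> \<bar>f t\<bar> \<le> g t"
    and "0 \<le> x"
  shows "\<bar>primitive f x\<bar> \<le> G x - G 0"
proof -
  have "G 0 - primitive f 0 \<le> G x - primitive f x"
    using \<open>0 \<le> x\<close>
  proof (rule DERIV_nonneg_imp_nondecreasing, intro exI conjI)
    fix t assume "0 \<le> t" "t \<le> x"
    show "((\<lambda>x. G x - primitive f x) has_real_derivative g t - f t) (at t)"
      by (intro derivative_intros G primitive_deriv f \<open>0 \<le> t\<close> \<open>t \<le> x\<close>)
    show "0 \<le> g t - f t" using le[OF \<open>0 \<le> t\<close> \<open>t \<le> x\<close>] by linarith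
  qed
  moreover have "G 0 + primitive f 0 \<le> G x + primitive f x"
    using \<open>0 \<le> x\<close>
  proof (rule DERIV_nonneg_imp_nondecreasing, intro exI conjI)
    fix t assume "0 \<le> t" "t \<le> x"
    show "((\<lambda>x. G x + primitive f x) has_real_derivative g t + f t) (at t)"
      by (intro derivative_intros G primitive_deriv f \<open>0 \<le> t\<close> \<open>t \<le> x\<close>)
    show "0 \<le> g t + f t" using le[OF \<open>0 \<le> t\<close> \<open>t \<le> x\<close>] by linarith
  qed
  ultimately show ?thesis by simp
qed

text \<open>A fundamental system at energy E with Wronskian 1: u decays at rate \<kappa> and w grows
  at most at the same rate. One constant \<open>A\<close> serves all four bounds.\<close>

locale solution_pair =
  fixes q u u' w w' :: "real \<Rightarrow> real" and \<kappa> A :: real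
  assumes cont_q: "continuous_on UNIV q"
    and deriv_u: "\<And>x. (u has_real_derivative u' x) (at x)"
    and deriv_u': "\<And>x. (u' has_real_derivative q x * u x) (at x)"
    and deriv_w: "\<And>x. (w has_real_derivative w' x) (at x)"
    and deriv_w': "\<And>x. (w' has_real_derivative q x * w x) (at x)"
    and wronskian: "\<And>x. u x * w' x - u' x * w x = 1"
    and \<kappa>_pos: "\<kappa> > 0" and A_ge_1: "A \<ge> 1"
    and u_le: "\<And>x. x \<ge> 0 \<Longrightarrow> \<bar>u x\<bar> \<le> A * exp (- \<kappa> * x)"
    and u'_le: "\<And>x. x \<ge> 0 \<Longrightarrow> \<bar>u' x\<bar> \<le> A * exp (- \<kappa> * x)"
    and w_le: "\<And>x. x \<ge> 0 \<Longrightarrow> \<bar>w x\<bar> \<le> A * exp (\<kappa> * x)"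
    and w'_le: "\<And>x. x \<ge> 0 \<Longrightarrow> \<bar>w' x\<bar> \<le> A * exp (\<kappa> * x)"

text \<open>Variation of constants: the second solution is sought as \<open>w = g u - u' / R\<close> with
  \<open>R\<close> the energy of \<open>u\<close>, which has Wronskian 1 with \<open>u\<close> for every \<open>g\<close>; the equation for \<open>w\<close>
  then determines \<open>g'\<close>, of size \<open>1 / R\<close>.\<close>

lemma (in square_integrable_solution) ex_solution_pair:
  obtains w w' \<kappa> A where "solution_pair q u u' w w' \<kappa> A"
proof -
  obtain \<kappa> m C where \<kappa>: "\<kappa> > 0" and m: "m > 0" and "C > 0"
    and lower: "\<And>x. x \<ge> 0 \<Longrightarrow> m * exp (- (2 * \<kappa> * x)) \<le> energy x"
    and upper: "\<And>x. x \<ge> 0 \<Longrightarrow> energy x \<le> C * exp (- (2 * \<kappa> * x))"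
    using energy_exponential by blast
  \<comment> \<open>With R the energy of u, the requirement w' = g u' + u / R reads g' u = u / R +
    (u' / R)'. Inserting R' = 2 (1 + q) u u' gives this formula.\<close>
  define g' where "g' x = (1 + q x) * ((u x)\<^sup>2 - (u' x)\<^sup>2) / (energy x)\<^sup>2" for x
  define g where "g = primitive g'"
  define w where "w x = g x * u x - u' x / energy x" for x
  define w' where "w' x = g x * u' x + u x / energy x" for x
  have nz [simp]: "energy x \<noteq> 0" for x using energy_pos[of x] by simp
  have cont_g': "continuous_on UNIV g'"
    unfolding g'_def by (intro continuous_intros cont_q cont_u cont_u' cont_energy) auto
  have deriv_g: "(g has_real_derivative g' x) (at x)" for x
    unfolding g_def by (rule primitive_deriv[OF cont_g'])
  have deriv_energy: "(energy has_real_derivative 2 * (1 + q x) * u x * u' x) (at x)" for x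
    unfolding energy_def[abs_def]
    by (auto intro!: derivative_eq_intros deriv_u deriv_u' simp: algebra_simps)
  have deriv_w: "(w has_real_derivative w' x) (at x)" for x
  proof -
    have "(w has_real_derivative g' x * u x + g x * u' x -
        (q x * u x * energy x - u' x * (2 * (1 + q x) * u x * u' x)) / (energy x)\<^sup>2) (at x)"
      unfolding w_def
      by (auto intro!: derivative_eq_intros deriv_g deriv_u deriv_u' deriv_energy
          simp: power2_eq_square)
    also have "g' x * u x + g x * u' x -
        (q x * u x * energy x - u' x * (2 * (1 + q x) * u x * u' x)) / (energy x)\<^sup>2 = w' x"
    proof -
      have "(1 + q x) * ((u x)\<^sup>2 - (u' x)\<^sup>2) * u x -
          (q x * u x * energy x - u' x * (2 * (1 + q x) * u x * u' x)) = u x * energy x"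
        unfolding energy_def by (simp add: power2_eq_square algebra_simps)
      hence "g' x * u x - (q x * u x * energy x - u' x * (2 * (1 + q x) * u x * u' x)) / (energy x)\<^sup>2 =
          u x * energy x / (energy x)\<^sup>2"
        unfolding g'_def by (metis diff_divide_distrib times_divide_eq_left)
      thus ?thesis by (simp add: w'_def power2_eq_square)
    qed
    finally show ?thesis .
  qed
  have deriv_w': "(w' has_real_derivative q x * w x) (at x)" for x
  proof -
    have "(w' has_real_derivative g' x * u' x + g x * (q x * u x) +
        (u' x * energy x - u x * (2 * (1 + q x) * u x * u' x)) / (energy x)\<^sup>2) (at x)"
      unfolding w'_def
      by (auto intro!: derivative_eq_intros deriv_g deriv_u deriv_u' deriv_energy
          simp: power2_eq_square)
    also have "g' x * u' x + g x * (q x * u x) +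
        (u' x * energy x - u x * (2 * (1 + q x) * u x * u' x)) / (energy x)\<^sup>2 = q x * w x"
    proof -
      have "(1 + q x) * ((u x)\<^sup>2 - (u' x)\<^sup>2) * u' x +
          (u' x * energy x - u x * (2 * (1 + q x) * u x * u' x)) = - q x * u' x * energy x"
        unfolding energy_def by (simp add: power2_eq_square algebra_simps)
      hence "g' x * u' x + (u' x * energy x - u x * (2 * (1 + q x) * u x * u' x)) / (energy x)\<^sup>2 =
          - q x * u' x * energy x / (energy x)\<^sup>2"
        unfolding g'_def by (metis add_divide_distrib times_divide_eq_left)
      thus ?thesis by (simp add: w_def power2_eq_square algebra_simps)
    qed
    finally show ?thesis .
  qed
  have wronskian: "u x * w' x - u' x * w x = 1" for x
  proof -
    have "u x * w' x - u' x * w x = ((u x)\<^sup>2 + (u' x)\<^sup>2) / energy x"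
      by (simp add: w_def w'_def power2_eq_square algebra_simps add_divide_distrib)
    thus ?thesis by (simp flip: energy_def)
  qed
  \<comment> \<open>The majorant (1 + K) exp(2 \<kappa> t) / m of |g'| has antiderivative D exp(2
    \<kappa> t).\<close>
  define D where "D = (1 + K) / (2 * \<kappa> * m)"
  have "D \<ge> 0" using K_nonneg \<kappa> m by (simp add: D_def)
  have g_le: "\<bar>g x\<bar> \<le> D * exp (2 * \<kappa> * x)" if "x \<ge> 0" for x
  proof -
    have "\<bar>g x\<bar> \<le> D * exp (2 * \<kappa> * x) - D * exp (2 * \<kappa> * 0)"
      unfolding g_def using cont_g' _ _ that
    proof (rule primitive_bound)
      fix t :: real assume t: "0 \<le> t"
      show "((\<lambda>x. D * exp (2 * \<kappa> * x)) has_real_derivative D * (exp (2 * \<kappa> * t) * (2 * \<kappa>))) (at t)"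
        by (auto intro!: derivative_eq_intros)
      have "\<bar>g' t\<bar> = \<bar>1 + q t\<bar> * \<bar>(u t)\<^sup>2 - (u' t)\<^sup>2\<bar> / (energy t)\<^sup>2"
        by (simp add: g'_def abs_mult)
      also have "\<dots> \<le> (1 + K) * energy t / (energy t)\<^sup>2"
        using q_bound[OF t] K_nonneg
        by (intro divide_right_mono mult_mono) (auto simp: energy_def abs_le_iff)
      also have "\<dots> = (1 + K) / energy t" by (simp add: power2_eq_square)
      also have "\<dots> \<le> (1 + K) / (m * exp (- (2 * \<kappa> * t)))"
        using K_nonneg m energy_pos lower[OF t] by (intro divide_left_mono) (auto intro!: mult_pos_pos)
      also have "\<dots> = D * (exp (2 * \<kappa> * t) * (2 * \<kappa>))"
        using m \<kappa> by (simp add: D_def exp_minus field_simps)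
      finally show "\<bar>g' t\<bar> \<le> D * (exp (2 * \<kappa> * t) * (2 * \<kappa>))" .
    qed
    thus ?thesis using \<open>D \<ge> 0\<close> by simp
  qed
  have exp_half: "exp (- (2 * \<kappa> * x)) = (exp (- \<kappa> * x))\<^sup>2" for x
    by (simp flip: exp_double)
  have abs_le: "\<bar>u x\<bar> \<le> sqrt (energy x)" "\<bar>u' x\<bar> \<le> sqrt (energy x)" for x
    by (auto simp: energy_def intro: real_le_rsqrt)
  have upper': "sqrt (energy x) \<le> sqrt C * exp (- \<kappa> * x)" if "x \<ge> 0" for x
    using real_sqrt_le_mono[OF upper[OF that]] unfolding exp_half real_sqrt_mult by simp
  have lower': "sqrt m * exp (- \<kappa> * x) \<le> sqrt (energy x)" if "x \<ge> 0" for x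
    using real_sqrt_le_mono[OF lower[OF that]] unfolding exp_half real_sqrt_mult by simp
  have quot_le: "\<bar>y / energy x\<bar> \<le> exp (\<kappa> * x) / sqrt m" if "x \<ge> 0" "\<bar>y\<bar> \<le> sqrt (energy x)" for x y
  proof -
    have "\<bar>y / energy x\<bar> \<le> sqrt (energy x) / energy x"
      using that energy_pos[of x] by (simp add: abs_divide divide_right_mono)
    also have "\<dots> = 1 / sqrt (energy x)"
      using energy_pos[of x] by (simp add: field_simps)
    also have "\<dots> \<le> 1 / (sqrt m * exp (- \<kappa> * x))"
      using lower'[OF that(1)] m energy_pos[of x] by (intro divide_left_mono) auto
    finally show ?thesis by (simp add: exp_minus field_simps)
  qed
  have g_mult_le: "\<bar>g x * y\<bar> \<le> D * sqrt C * exp (\<kappa> * x)" if "x \<ge> 0" "\<bar>y\<bar> \<le> sqrt (energy x)" for x y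
  proof -
    have "\<bar>g x * y\<bar> \<le> (D * exp (2 * \<kappa> * x)) * (sqrt C * exp (- \<kappa> * x))"
      unfolding abs_mult using g_le[OF that(1)] that upper'[OF that(1)] \<open>D \<ge> 0\<close>
      by (intro mult_mono) auto
    also have "\<dots> = D * sqrt C * (exp (2 * \<kappa> * x) * exp (- \<kappa> * x))" by simp
    also have "exp (2 * \<kappa> * x) * exp (- \<kappa> * x) = exp (\<kappa> * x)" by (simp flip: exp_add)
    finally show ?thesis .
  qed
  \<comment> \<open>\<open>sqrt C\<close> serves u and u', the bracket serves the two summands of w
    and w', and the 1 secures A >= 1.\<close>
  define A where "A = 1 + sqrt C + (D * sqrt C + 1 / sqrt m)"
  have w_le: "\<bar>w x\<bar> \<le> A * exp (\<kappa> * x)" "\<bar>w' x\<bar> \<le> A * exp (\<kappa> * x)" if "x \<ge> 0" for x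
  proof -
    have "D * sqrt C * exp (\<kappa> * x) + exp (\<kappa> * x) / sqrt m \<le> A * exp (\<kappa> * x)"
      using \<open>C > 0\<close> by (simp add: A_def algebra_simps)
    thus "\<bar>w x\<bar> \<le> A * exp (\<kappa> * x)" "\<bar>w' x\<bar> \<le> A * exp (\<kappa> * x)"
      using g_mult_le[OF that abs_le(1)[of x]] g_mult_le[OF that abs_le(2)[of x]]
        quot_le[OF that abs_le(1)[of x]] quot_le[OF that abs_le(2)[of x]]
      unfolding w_def w'_def by linarith+
  qed
  have u_le: "\<bar>u x\<bar> \<le> A * exp (- \<kappa> * x)" "\<bar>u' x\<bar> \<le> A * exp (- \<kappa> * x)" if "x \<ge> 0" for x
  proof -
    have "sqrt C * exp (- \<kappa> * x) \<le> A * exp (- \<kappa> * x)"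
      using \<open>D \<ge> 0\<close> \<open>C > 0\<close> m by (simp add: A_def)
    thus "\<bar>u x\<bar> \<le> A * exp (- \<kappa> * x)" "\<bar>u' x\<bar> \<le> A * exp (- \<kappa> * x)"
      using abs_le[of x] upper'[OF that] by linarith+
  qed
  have "A \<ge> 1" using \<open>D \<ge> 0\<close> \<open>C > 0\<close> m by (simp add: A_def)
  have "solution_pair q u u' w w' \<kappa> A"
    unfolding solution_pair_def
    using cont_q deriv_u deriv_u' deriv_w deriv_w' wronskian \<kappa> \<open>A \<ge> 1\<close> u_le w_le by blast
  thus ?thesis by (rule that)
qed

section \<open>Expansion in the spectral parameter\<close>

text \<open>The Weierstrass test makes the series of derivatives converge uniformly, so convergence
  of the original series at the single point \<open>x0\<close> is enough for termwise
  differentiation.\<close>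

lemma has_vector_derivative_series:
  fixes f f' :: "nat \<Rightarrow> real \<Rightarrow> 'b::banach"
  assumes "convex S"
    and f: "\<And>n x. x \<in> S \<Longrightarrow> (f n has_vector_derivative f' n x) (at x within S)"
    and m: "\<And>n x. x \<in> S \<Longrightarrow> norm (f' n x) \<le> m n" "summable m"
    and x0: "x0 \<in> S" "summable (\<lambda>n. f n x0)"
    and "x \<in> S"
  shows "((\<lambda>x. \<Sum>n. f n x) has_vector_derivative (\<Sum>n. f' n x)) (at x within S)"
proof -
  have lim: "uniform_limit S (\<lambda>n x. \<Sum>i<n. f' i x) (\<lambda>x. \<Sum>n. f' n x) sequentially"
    by (rule Weierstrass_m_test) (use m in auto)
  have "\<exists>g. \<forall>x\<in>S. (\<lambda>n. f n x) sums g x \<and> (g has_derivative (\<lambda>h. h *\<^sub>R (\<Sum>n. f' n x))) (at x within S)"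
  proof (rule has_derivative_series[where f = f and f' = "\<lambda>n x h. h *\<^sub>R f' n x" and x = x0
        and l = "\<Sum>n. f n x0"])
    show "(f n has_derivative (\<lambda>h. h *\<^sub>R f' n x)) (at x within S)" if "x \<in> S" for n x
      using f[OF that] by (simp add: has_vector_derivative_def)
    show "\<forall>\<^sub>F n in sequentially. \<forall>x\<in>S. \<forall>h. norm ((\<Sum>i<n. h *\<^sub>R f' i x) - h *\<^sub>R (\<Sum>n. f' n x)) \<le> e * norm h"
      if "e > 0" for e
      using uniform_limitD[OF lim that]
    proof eventually_elim
      case (elim n)
      have "norm ((\<Sum>i<n. h *\<^sub>R f' i x) - h *\<^sub>R (\<Sum>n. f' n x)) \<le> e * norm h" if "x \<in> S" for x h
      proof -
        have "(\<Sum>i<n. h *\<^sub>R f' i x) - h *\<^sub>R (\<Sum>n. f' n x) = h *\<^sub>R ((\<Sum>i<n. f' i x) - (\<Sum>n. f' n x))"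
          by (simp add: scaleR_sum_right scaleR_diff_right)
        moreover have "norm ((\<Sum>i<n. f' i x) - (\<Sum>n. f' n x)) \<le> e"
          using elim that by (auto simp: dist_norm intro: less_imp_le)
        ultimately show ?thesis by (simp add: mult.commute[of e] mult_left_mono)
      qed
      thus ?case by blast
    qed
  qed (use \<open>convex S\<close> x0 summable_sums in auto)
  then obtain g where g: "\<And>x. x \<in> S \<Longrightarrow> (\<lambda>n. f n x) sums g x"
    "\<And>x. x \<in> S \<Longrightarrow> (g has_vector_derivative (\<Sum>n. f' n x)) (at x within S)"
    by (auto simp: has_vector_derivative_def)
  show ?thesis
    by (rule has_vector_derivative_transform[OF \<open>x \<in> S\<close> _ g(2)[OF \<open>x \<in> S\<close>]])
       (use g(1) in \<open>auto simp: sums_iff\<close>)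
qed

text \<open>Everything is compared with K exp(\<beta> |z|). Differentiation only replaces K by K
  \<beta>, so the same estimates apply again to \<open>diffs a\<close>. The last bound is the mean
  value inequality on the ball of radius |z|.\<close>

lemma exp_type_series:
  fixes a :: "nat \<Rightarrow> complex"
  assumes a: "\<And>n. cmod (a n) \<le> K * \<beta> ^ n / fact n" and "\<beta> \<ge> 0"
  shows "summable (\<lambda>n. a n * z ^ n)"
    and "cmod (\<Sum>n. a n * z ^ n) \<le> K * exp (\<beta> * cmod z)"
    and "((\<lambda>z. \<Sum>n. a n * z ^ n) has_field_derivative (\<Sum>n. diffs a n * z ^ n)) (at z)"
    and "cmod (diffs a n) \<le> K * \<beta> * \<beta> ^ n / fact n"
    and "cmod ((\<Sum>n. a n * z ^ n) - a 0) \<le> K * \<beta> * exp (\<beta> * cmod z) * cmod z"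
proof -
  have sum1: "summable (\<lambda>n. a n * z ^ n)" and sum2: "cmod (\<Sum>n. a n * z ^ n) \<le> K * exp (\<beta> * cmod z)"
    if a: "\<And>n. cmod (a n) \<le> K * \<beta> ^ n / fact n" for a z K
  proof -
    have le: "cmod (a n * z ^ n) \<le> K * ((\<beta> * cmod z) ^ n /\<^sub>R fact n)" for n
      using mult_right_mono[OF a[of n], of "cmod z ^ n"]
      by (simp add: norm_mult norm_power power_mult_distrib divide_simps mult_ac)
    have exp: "(\<lambda>n. K * ((\<beta> * cmod z) ^ n /\<^sub>R fact n)) sums (K * exp (\<beta> * cmod z))"
      by (intro sums_mult exp_converges)
    have "summable (\<lambda>n. cmod (a n * z ^ n))"
      by (rule summable_comparison_test'[OF sums_summable[OF exp], of 0]) (use le in auto)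
    thus "summable (\<lambda>n. a n * z ^ n)" by (rule summable_norm_cancel)
    have "cmod (\<Sum>n. a n * z ^ n) \<le> (\<Sum>n. cmod (a n * z ^ n))"
      by (rule summable_norm) fact
    also have "\<dots> \<le> (\<Sum>n. K * ((\<beta> * cmod z) ^ n /\<^sub>R fact n))"
      by (rule suminf_le[OF le]) (use \<open>summable (\<lambda>n. cmod (a n * z ^ n))\<close> exp in \<open>auto simp: sums_iff\<close>)
    also have "\<dots> = K * exp (\<beta> * cmod z)" using exp by (simp add: sums_iff)
    finally show "cmod (\<Sum>n. a n * z ^ n) \<le> K * exp (\<beta> * cmod z)" .
  qed
  show "summable (\<lambda>n. a n * z ^ n)" "cmod (\<Sum>n. a n * z ^ n) \<le> K * exp (\<beta> * cmod z)"
    using sum1[OF a] sum2[OF a] by blast+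
  have deriv: "((\<lambda>z. \<Sum>n. a n * z ^ n) has_field_derivative (\<Sum>n. diffs a n * z ^ n)) (at z)" for z
    by (rule termdiffs_strong_converges_everywhere) (rule sum1[OF a])
  thus "((\<lambda>z. \<Sum>n. a n * z ^ n) has_field_derivative (\<Sum>n. diffs a n * z ^ n)) (at z)" .
  have diffs: "cmod (diffs a n) \<le> K * \<beta> * \<beta> ^ n / fact n" for n
  proof -
    have "cmod (diffs a n) = real (Suc n) * cmod (a (Suc n))"
      unfolding diffs_def norm_mult norm_of_nat ..
    also have "\<dots> \<le> real (Suc n) * (K * \<beta> ^ Suc n / fact (Suc n))"
      by (intro mult_left_mono a) auto
    also have "\<dots> = K * \<beta> * \<beta> ^ n / fact n" by (simp add: divide_simps add_eq_0_iff)
    finally show ?thesis .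
  qed
  thus "cmod (diffs a n) \<le> K * \<beta> * \<beta> ^ n / fact n" .
  have "K \<ge> 0" using order_trans[OF norm_ge_zero a[of 0]] by simp
  have "cmod ((\<Sum>n. a n * z ^ n) - (\<Sum>n. a n * 0 ^ n)) \<le> K * \<beta> * exp (\<beta> * cmod z) * cmod (z - 0)"
  proof (rule field_differentiable_bound)
    fix y :: complex assume y: "y \<in> cball 0 (cmod z)"
    show "((\<lambda>z. \<Sum>n. a n * z ^ n) has_field_derivative (\<Sum>n. diffs a n * y ^ n)) (at y within cball 0 (cmod z))"
      by (rule has_field_derivative_at_within[OF deriv])
    have "cmod (\<Sum>n. diffs a n * y ^ n) \<le> K * \<beta> * exp (\<beta> * cmod y)"
      by (rule sum2[OF diffs])
    also have "\<dots> \<le> K * \<beta> * exp (\<beta> * cmod z)"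
      using y \<open>K \<ge> 0\<close> \<open>\<beta> \<ge> 0\<close> by (intro mult_left_mono) (auto intro: mult_left_mono)
    finally show "cmod (\<Sum>n. diffs a n * y ^ n) \<le> K * \<beta> * exp (\<beta> * cmod z)" .
  qed auto
  thus "cmod ((\<Sum>n. a n * z ^ n) - a 0) \<le> K * \<beta> * exp (\<beta> * cmod z) * cmod z"
    by simp
qed

section \<open>Taylor expansion of the solution around the energy E\<close>

context solution_pair
begin

text \<open>The Taylor coefficients at \<open>z = E\<close> of the solution of \<open>y'' = (V - z) y\<close>, where
  \<open>q = V - E\<close>; they are found by variation of constants.\<close>

primrec taylor :: "nat \<Rightarrow> real \<Rightarrow> real" where
  "taylor 0 = u"
| "taylor (Suc n) = (\<lambda>x. u x * primitive (\<lambda>t. w t * taylor n t) x - w x * primitive (\<lambda>t. u t * taylor n t) x)"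

primrec taylor' :: "nat \<Rightarrow> real \<Rightarrow> real" where
  "taylor' 0 = u'"
| "taylor' (Suc n) = (\<lambda>x. u' x * primitive (\<lambda>t. w t * taylor n t) x - w' x * primitive (\<lambda>t. u t * taylor n t) x)"

lemma continuous_pair: "continuous_on S u" "continuous_on S u'" "continuous_on S w" "continuous_on S w'"
  by (rule DERIV_continuous_on, rule DERIV_subset, rule deriv_u deriv_u' deriv_w deriv_w', simp)+

lemma cont_taylor: "continuous_on UNIV (taylor n)"
proof (induction n)
  case (Suc n)
  have "continuous_on UNIV (primitive f)" if "continuous_on UNIV f" for f
    by (rule DERIV_continuous_on) (auto intro: primitive_deriv that)
  from this[of "\<lambda>t. w t * taylor n t"] this[of "\<lambda>t. u t * taylor n t"] show ?case
    unfolding taylor.simps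
    using continuous_on_mult[OF continuous_pair(1) Suc.IH] continuous_on_mult[OF continuous_pair(3) Suc.IH]
    by (intro continuous_on_diff continuous_on_mult continuous_pair) auto
qed (auto intro: continuous_pair)

lemma deriv_primitive_taylor:
  "(primitive (\<lambda>t. w t * taylor n t) has_real_derivative w x * taylor n x) (at x)"
  "(primitive (\<lambda>t. u t * taylor n t) has_real_derivative u x * taylor n x) (at x)"
  by (intro primitive_deriv continuous_intros continuous_pair cont_taylor)+

lemma deriv_taylor: "(taylor n has_real_derivative taylor' n x) (at x)"
  by (cases n) (auto intro!: derivative_eq_intros deriv_primitive_taylor deriv_u deriv_w
      simp: algebra_simps)

lemma deriv_taylor'_0: "(taylor' 0 has_real_derivative q x * taylor 0 x) (at x)"
  by (auto intro: deriv_u')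

lemma deriv_taylor'_Suc:
  "(taylor' (Suc n) has_real_derivative q x * taylor (Suc n) x - taylor n x) (at x)"
proof -
  \<comment> \<open>Differentiating the two primitives leaves minus the Wronskian of u and w times
    the previous coefficient, which is the source term of the next order.\<close>
  have "u' x * (w x * taylor n x) - w' x * (u x * taylor n x) = - (u x * w' x - u' x * w x) * taylor n x"
    by (simp add: algebra_simps)
  hence *: "u' x * (w x * taylor n x) - w' x * (u x * taylor n x) = - taylor n x"
    by (simp add: wronskian)
  have "(taylor' (Suc n) has_real_derivative
      q x * taylor (Suc n) x + (u' x * (w x * taylor n x) - w' x * (u x * taylor n x))) (at x)"
    by (auto intro!: derivative_eq_intros deriv_primitive_taylor deriv_u' deriv_w'
      simp: algebra_simps)
  thus ?thesis unfolding * by simp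
qed

lemma taylor_at_0 [simp]: "taylor (Suc n) 0 = 0" "taylor' (Suc n) 0 = 0"
  by simp_all

text \<open>The exponential rate does not worsen with n: the integral of w times the previous
  coefficient grows like exp(2 \<kappa> x) but is multiplied by the decaying u, while in u times the
  previous coefficient the exponentials cancel before multiplication by w. The factor 2 counts these
  two products.\<close>

lemma taylor_bound:
  assumes "x \<ge> 0"
  shows "\<bar>taylor n x\<bar> \<le> A * exp (\<kappa> * x) * (2 * A\<^sup>2 * x) ^ n / fact n \<and>
         \<bar>taylor' n x\<bar> \<le> A * exp (\<kappa> * x) * (2 * A\<^sup>2 * x) ^ n / fact n"
  using assms
proof (induction n arbitrary: x)
  case 0
  have "- \<kappa> * x \<le> \<kappa> * x" using \<kappa>_pos 0 by (simp add: mult_le_0_iff)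
  hence "A * exp (- \<kappa> * x) \<le> A * exp (\<kappa> * x)"
    using A_ge_1 by (intro mult_left_mono) auto
  thus ?case using u_le[OF 0] u'_le[OF 0] by auto
next
  case (Suc n)
  \<comment> \<open>The antiderivative, vanishing at 0, of the polynomial factor in the induction
    hypothesis; it supplies the new power of x and the factor 1 / (n + 1).\<close>
  define P where "P t = (2 * A\<^sup>2) ^ n * t ^ Suc n / fact (Suc n)" for t :: real
  have P': "(P has_real_derivative (2 * A\<^sup>2 * t) ^ n / fact n) (at t)" for t
  proof -
    have "((\<lambda>t. t ^ Suc n) has_real_derivative real (Suc n) * t ^ n) (at t)"
      using DERIV_pow[of "Suc n" t] by simp
    from DERIV_cdivide[OF DERIV_cmult[OF this], of "(2 * A\<^sup>2) ^ n" "fact (Suc n)"]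
    show ?thesis
      unfolding P_def by (simp add: power_mult_distrib divide_simps add_eq_0_iff ac_simps)
  qed
  have "P x \<ge> 0" using Suc.prems by (simp add: P_def)
  have pw: "\<bar>primitive (\<lambda>t. w t * taylor n t) x\<bar> \<le> A\<^sup>2 * exp (2 * \<kappa> * x) * P x"
  proof -
    have "\<bar>primitive (\<lambda>t. w t * taylor n t) x\<bar> \<le> A\<^sup>2 * exp (2 * \<kappa> * x) * P x - A\<^sup>2 * exp (2 * \<kappa> * x) * P 0"
    proof (rule primitive_bound)
      fix t assume t: "0 \<le> t" "t \<le> x"
      show "((\<lambda>t. A\<^sup>2 * exp (2 * \<kappa> * x) * P t) has_real_derivative
          A\<^sup>2 * exp (2 * \<kappa> * x) * ((2 * A\<^sup>2 * t) ^ n / fact n)) (at t)"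
        by (intro DERIV_cmult P')
      have "\<bar>w t * taylor n t\<bar> \<le> (A * exp (\<kappa> * t)) * (A * exp (\<kappa> * t) * (2 * A\<^sup>2 * t) ^ n / fact n)"
        unfolding abs_mult using w_le[OF t(1)] Suc.IH[OF t(1)] A_ge_1 by (intro mult_mono) auto
      also have "\<dots> = A\<^sup>2 * exp (2 * \<kappa> * t) * ((2 * A\<^sup>2 * t) ^ n / fact n)"
        using exp_double[of "\<kappa> * t"] by (simp add: power2_eq_square mult.assoc)
      also have "\<dots> \<le> A\<^sup>2 * exp (2 * \<kappa> * x) * ((2 * A\<^sup>2 * t) ^ n / fact n)"
        using t \<kappa>_pos by (intro mult_right_mono mult_left_mono) auto
      finally show "\<bar>w t * taylor n t\<bar> \<le> A\<^sup>2 * exp (2 * \<kappa> * x) * ((2 * A\<^sup>2 * t) ^ n / fact n)" .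
    qed (auto intro!: continuous_intros continuous_pair cont_taylor Suc.prems)
    thus ?thesis by (simp add: P_def)
  qed
  have pu: "\<bar>primitive (\<lambda>t. u t * taylor n t) x\<bar> \<le> A\<^sup>2 * P x"
  proof -
    have "\<bar>primitive (\<lambda>t. u t * taylor n t) x\<bar> \<le> A\<^sup>2 * P x - A\<^sup>2 * P 0"
    proof (rule primitive_bound)
      fix t assume t: "0 \<le> t" "t \<le> x"
      show "((\<lambda>t. A\<^sup>2 * P t) has_real_derivative A\<^sup>2 * ((2 * A\<^sup>2 * t) ^ n / fact n)) (at t)"
        by (intro DERIV_cmult P')
      have "\<bar>u t * taylor n t\<bar> \<le> (A * exp (- \<kappa> * t)) * (A * exp (\<kappa> * t) * (2 * A\<^sup>2 * t) ^ n / fact n)"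
        unfolding abs_mult using u_le[OF t(1)] Suc.IH[OF t(1)] A_ge_1 by (intro mult_mono) auto
      also have "\<dots> = A\<^sup>2 * (exp (- \<kappa> * t) * exp (\<kappa> * t)) * ((2 * A\<^sup>2 * t) ^ n / fact n)"
        by (simp add: power2_eq_square)
      also have "exp (- \<kappa> * t) * exp (\<kappa> * t) = 1"
        by (simp flip: exp_add)
      finally show "\<bar>u t * taylor n t\<bar> \<le> A\<^sup>2 * ((2 * A\<^sup>2 * t) ^ n / fact n)" by simp
    qed (auto intro!: continuous_intros continuous_pair cont_taylor Suc.prems)
    thus ?thesis by (simp add: P_def)
  qed
  have bound: "\<bar>a * primitive (\<lambda>t. w t * taylor n t) x - b * primitive (\<lambda>t. u t * taylor n t) x\<bar>
      \<le> A * exp (\<kappa> * x) * (2 * A\<^sup>2 * x) ^ Suc n / fact (Suc n)"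
    if a: "\<bar>a\<bar> \<le> A * exp (- \<kappa> * x)" and b: "\<bar>b\<bar> \<le> A * exp (\<kappa> * x)" for a b
  proof -
    have "\<bar>a * primitive (\<lambda>t. w t * taylor n t) x\<bar> \<le> A * exp (- \<kappa> * x) * (A\<^sup>2 * exp (2 * \<kappa> * x) * P x)"
      unfolding abs_mult using a pw A_ge_1 by (intro mult_mono) auto
    also have "\<dots> = A * (exp (- \<kappa> * x) * exp (2 * \<kappa> * x)) * (A\<^sup>2 * P x)" by simp
    also have "exp (- \<kappa> * x) * exp (2 * \<kappa> * x) = exp (\<kappa> * x)" by (simp flip: exp_add)
    finally have 1: "\<bar>a * primitive (\<lambda>t. w t * taylor n t) x\<bar> \<le> A * exp (\<kappa> * x) * (A\<^sup>2 * P x)" .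
    have 2: "\<bar>b * primitive (\<lambda>t. u t * taylor n t) x\<bar> \<le> A * exp (\<kappa> * x) * (A\<^sup>2 * P x)"
      unfolding abs_mult using b pu A_ge_1 by (intro mult_mono) auto
    have "A * exp (\<kappa> * x) * (2 * A\<^sup>2 * x) ^ Suc n / fact (Suc n) = 2 * (A * exp (\<kappa> * x) * (A\<^sup>2 * P x))"
      by (simp add: P_def power_mult_distrib)
    thus ?thesis using 1 2 by linarith
  qed
  show ?case
    using bound[OF u_le[OF Suc.prems] w_le[OF Suc.prems]] bound[OF u'_le[OF Suc.prems] w'_le[OF Suc.prems]]
    by simp
qed

text \<open>\<open>taylor 1\<close> is the derivative of the solution in z at E. In its variation of
  constants formula the terms with the primitive of w u cancel, and the others combine to the
  Wronskian of u and w.\<close>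

lemma taylor_1_wronskian:
  "u x * taylor' 1 x - u' x * taylor 1 x = - primitive (\<lambda>t. (u t)\<^sup>2) x"
proof -
  have "u x * taylor' 1 x - u' x * taylor 1 x =
      - (u x * w' x - u' x * w x) * primitive (\<lambda>t. u t * u t) x"
    by (simp add: algebra_simps)
  thus ?thesis by (simp add: wronskian power2_eq_square)
qed

lemma taylor_coeff_bound:
  assumes "x \<ge> 0"
  shows "cmod (of_real (taylor n x)) \<le> A * exp (\<kappa> * x) * (2 * A\<^sup>2 * x) ^ n / fact n"
    "cmod (of_real (taylor' n x)) \<le> A * exp (\<kappa> * x) * (2 * A\<^sup>2 * x) ^ n / fact n"
  using taylor_bound[OF assms, of n] by simp_all

text \<open>The variable \<zeta> is the offset z - E of the spectral parameter.\<close>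

definition sol :: "complex \<Rightarrow> real \<Rightarrow> complex" where
  "sol \<zeta> x = (\<Sum>n. of_real (taylor n x) * \<zeta> ^ n)"

definition sol' :: "complex \<Rightarrow> real \<Rightarrow> complex" where
  "sol' \<zeta> x = (\<Sum>n. of_real (taylor' n x) * \<zeta> ^ n)"

lemma summable_sol:
  fixes \<zeta> :: complex
  assumes "x \<ge> 0"
  shows "summable (\<lambda>n. of_real (taylor n x) * \<zeta> ^ n :: complex)"
    "summable (\<lambda>n. of_real (taylor' n x) * \<zeta> ^ n :: complex)"
  using exp_type_series(1)[OF taylor_coeff_bound(1)[OF assms], of \<zeta>]
    exp_type_series(1)[OF taylor_coeff_bound(2)[OF assms], of \<zeta>] assms by simp_all

lemma sol_0:
  fixes \<zeta> :: complex
  shows "sol \<zeta> 0 = u 0" "sol' \<zeta> 0 = u' 0"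
proof -
  have "taylor n 0 = (if n = 0 then u 0 else 0)" "taylor' n 0 = (if n = 0 then u' 0 else 0)" for n
    by (cases n; simp)+
  hence "(\<lambda>n. of_real (taylor n 0) * \<zeta> ^ n) = (\<lambda>n. if n = 0 then of_real (u 0) else 0)"
    "(\<lambda>n. of_real (taylor' n 0) * \<zeta> ^ n) = (\<lambda>n. if n = 0 then of_real (u' 0) else 0)"
    by auto
  thus "sol \<zeta> 0 = u 0" "sol' \<zeta> 0 = u' 0"
    unfolding sol_def sol'_def by (simp_all add: sums_unique[OF sums_single[of 0 "\<lambda>_. c" for c], symmetric])
qed

text \<open>The coefficient bounds are uniform on [0, M], which permits termwise differentiation
  twice; the recursion for the coefficients then sums to the differential equation.\<close>

lemma sol_deriv:
  fixes \<zeta> :: complex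
  assumes x: "x \<in> {0..M}"
  shows "(sol \<zeta> has_vector_derivative sol' \<zeta> x) (at x within {0..M})"
    and "(sol' \<zeta> has_vector_derivative (q x - \<zeta>) * sol \<zeta> x) (at x within {0..M})"
proof -
  define m where "m n = A * exp (\<kappa> * M) * ((2 * A\<^sup>2 * M * cmod \<zeta>) ^ n /\<^sub>R fact n)" for n
  have "m sums (A * exp (\<kappa> * M) * exp (2 * A\<^sup>2 * M * cmod \<zeta>))"
    unfolding m_def by (intro sums_mult exp_converges)
  hence m: "summable m" by (rule sums_summable)
  have bound: "cmod (of_real t * \<zeta> ^ n) \<le> m n"
    if "y \<in> {0..M}" "cmod (of_real t) \<le> A * exp (\<kappa> * y) * (2 * A\<^sup>2 * y) ^ n / fact n" for y n t
  proof -
    have "A * exp (\<kappa> * y) * ((2 * A\<^sup>2 * y) ^ n / fact n) \<le> A * exp (\<kappa> * M) * ((2 * A\<^sup>2 * M) ^ n / fact n)"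
      using that(1) A_ge_1 \<kappa>_pos
      by (intro mult_mono divide_right_mono power_mono mult_left_mono) auto
    hence "cmod (of_real t) \<le> A * exp (\<kappa> * M) * ((2 * A\<^sup>2 * M) ^ n / fact n)"
      using that(2) by simp
    from mult_right_mono[OF this, of "cmod \<zeta> ^ n"] show ?thesis
      by (simp add: norm_mult norm_power m_def power_mult_distrib divide_simps mult_ac)
  qed
  have tb: "cmod (of_real (taylor n y) * \<zeta> ^ n) \<le> m n" "cmod (of_real (taylor' n y) * \<zeta> ^ n) \<le> m n"
    if "y \<in> {0..M}" for n y
    using that by (auto intro!: bound[OF that] taylor_coeff_bound)
  have deriv: "((\<lambda>y. of_real (f y) * c) has_vector_derivative of_real d * c) (at y within S)"
    if "(f has_real_derivative d) (at y)" for f d y S and c :: complex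
    using that by (intro has_vector_derivative_mult_left has_vector_derivative_of_real)
      (simp add: has_real_derivative_iff_has_vector_derivative has_vector_derivative_at_within)
  have "((\<lambda>x. \<Sum>n. of_real (taylor n x) * \<zeta> ^ n) has_vector_derivative
      (\<Sum>n. of_real (taylor' n x) * \<zeta> ^ n)) (at x within {0..M})"
  proof (rule has_vector_derivative_series[OF _ _ _ m])
    show "((\<lambda>y. of_real (taylor n y) * \<zeta> ^ n) has_vector_derivative of_real (taylor' n y) * \<zeta> ^ n)
        (at y within {0..M})" for n y
      by (rule deriv[OF deriv_taylor])
  qed (use x tb summable_sol in auto)
  thus "(sol \<zeta> has_vector_derivative sol' \<zeta> x) (at x within {0..M})"
    by (simp add: sol_def[abs_def] sol'_def)
  \<comment> \<open>The coefficients shifted by one index, with value 0 at index 0, so that one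
    formula \<open>q y * taylor n y - p n y\<close> gives the derivative of \<open>taylor' n\<close>
    for all n. The shift turns into the factor \<zeta> in the series.\<close>
  define p where "p n y = (case n of 0 \<Rightarrow> 0 | Suc k \<Rightarrow> taylor k y)" for n y
  have p_Suc: "of_real (p (Suc n) y) * \<zeta> ^ Suc n = \<zeta> * (of_real (taylor n y) * \<zeta> ^ n)" for n y
    by (simp add: p_def)
  have deriv_taylor': "(taylor' n has_real_derivative q y * taylor n y - p n y) (at y)" for n y
    using deriv_taylor'_0 deriv_taylor'_Suc by (cases n) (auto simp: p_def)
  obtain L where L: "\<And>y. y \<in> {0..M} \<Longrightarrow> \<bar>q y\<bar> \<le> L"
  proof -
    have "compact (q ` {0..M})"
      by (intro compact_continuous_image continuous_on_subset[OF cont_q]) auto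
    thus ?thesis using that by (fastforce dest!: compact_imp_bounded simp: bounded_iff)
  qed
  define m' where "m' n = L * m n + (case n of 0 \<Rightarrow> 0 | Suc k \<Rightarrow> cmod \<zeta> * m k)" for n
  have "summable (\<lambda>n. case n of 0 \<Rightarrow> 0 | Suc k \<Rightarrow> cmod \<zeta> * m k)"
    by (subst summable_Suc_iff[symmetric]) (auto intro: summable_mult m)
  hence m': "summable m'"
    unfolding m'_def by (intro summable_add summable_mult m)
  have "((\<lambda>x. \<Sum>n. of_real (taylor' n x) * \<zeta> ^ n) has_vector_derivative
      (\<Sum>n. of_real (q x * taylor n x - p n x) * \<zeta> ^ n)) (at x within {0..M})"
  proof (rule has_vector_derivative_series[OF _ _ _ m'])
    show "((\<lambda>y. of_real (taylor' n y) * \<zeta> ^ n) has_vector_derivative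
        of_real (q y * taylor n y - p n y) * \<zeta> ^ n) (at y within {0..M})" for n y
      by (rule deriv[OF deriv_taylor'])
    show "cmod (of_real (q y * taylor n y - p n y) * \<zeta> ^ n) \<le> m' n" if y: "y \<in> {0..M}" for n y
    proof -
      have "of_real (q y * taylor n y - p n y) * \<zeta> ^ n =
          of_real (q y) * (of_real (taylor n y) * \<zeta> ^ n) - of_real (p n y) * \<zeta> ^ n"
        by (simp add: algebra_simps)
      also have "cmod \<dots> \<le> \<bar>q y\<bar> * cmod (of_real (taylor n y) * \<zeta> ^ n) + cmod (of_real (p n y) * \<zeta> ^ n)"
        by (rule order_trans[OF norm_triangle_ineq4]) (simp add: norm_mult)
      also have "\<dots> \<le> L * m n + (case n of 0 \<Rightarrow> 0 | Suc k \<Rightarrow> cmod \<zeta> * m k)"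
      proof (intro add_mono mult_mono L y tb)
        show "0 \<le> L" using L[OF y] by simp
        show "cmod (of_real (p n y) * \<zeta> ^ n) \<le> (case n of 0 \<Rightarrow> 0 | Suc k \<Rightarrow> cmod \<zeta> * m k)"
        proof (cases n)
          case (Suc k)
          thus ?thesis
            using mult_left_mono[OF tb(1)[OF y, of k], of "cmod \<zeta>"]
            by (simp add: p_def norm_mult mult_ac)
        qed (simp add: p_def)
      qed simp
      finally show ?thesis by (simp add: m'_def)
    qed
  qed (use x summable_sol in auto)
  moreover have "(\<lambda>n. of_real (q x * taylor n x - p n x) * \<zeta> ^ n) sums ((q x - \<zeta>) * sol \<zeta> x)"
  proof -
    have s: "(\<lambda>n. of_real (taylor n x) * \<zeta> ^ n) sums sol \<zeta> x"
      unfolding sol_def using x by (intro summable_sums summable_sol) auto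
    have "(\<lambda>n. of_real (p (Suc n) x) * \<zeta> ^ Suc n) sums (\<zeta> * sol \<zeta> x)"
      unfolding p_Suc by (rule sums_mult[OF s])
    hence "(\<lambda>n. of_real (p n x) * \<zeta> ^ n) sums (\<zeta> * sol \<zeta> x)"
      by (subst (asm) sums_Suc_iff) (simp add: p_def)
    from sums_diff[OF sums_mult[OF s, of "of_real (q x)"] this] show ?thesis
      by (simp add: algebra_simps)
  qed
  ultimately show "(sol' \<zeta> has_vector_derivative (q x - \<zeta>) * sol \<zeta> x) (at x within {0..M})"
    by (simp add: sol'_def[abs_def] sums_iff)
qed

text \<open>Whichever pair the choice operator returns, its difference from the series solution
  solves the same linear equation with zero initial data, hence vanishes at M.\<close>

lemma Theta_eq:
  fixes z :: complex and E :: real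
  assumes q: "q = (\<lambda>x. V x - E)" and "M \<ge> 0"
    and init: "if even_fun \<Phi> then u 0 = 1 \<and> u' 0 = 0 else u 0 = 0 \<and> u' 0 = 1"
  shows "Theta V \<Phi> M z = sol' (z - E) M - \<i> * csqrt z * sol (z - E) M"
proof -
  have ex: "solves_ivp V \<Phi> M z (sol (z - E)) (sol' (z - E))"
    unfolding solves_ivp_def
  proof (intro conjI exI ballI)
    fix x assume x: "x \<in> {0..M}"
    show "(sol (z - E) has_vector_derivative sol' (z - E) x) (at x within {0..M})"
      "(sol' (z - E) has_vector_derivative (q x - (z - E)) * sol (z - E) x) (at x within {0..M})"
      using sol_deriv[OF x] by blast+
    show "- ((q x - (z - E)) * sol (z - E) x) + of_real (V x) * sol (z - E) x - z * sol (z - E) x = 0"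
      by (simp add: q algebra_simps)
  qed (use init in \<open>auto simp: sol_0\<close>)
  define v v' where "v = fst (ivp_solution V \<Phi> M z)" and "v' = snd (ivp_solution V \<Phi> M z)"
  have pair: "ivp_solution V \<Phi> M z = (v, v')" by (simp add: v_def v'_def)
  have "case ivp_solution V \<Phi> M z of (v, v') \<Rightarrow> solves_ivp V \<Phi> M z v v'"
    unfolding ivp_solution_def by (rule someI[of _ "(sol (z - E), sol' (z - E))"]) (use ex in simp)
  hence ivp: "solves_ivp V \<Phi> M z v v'" by (simp add: pair)
  then obtain v'' where v: "\<And>x. x \<in> {0..M} \<Longrightarrow> (v has_vector_derivative v' x) (at x within {0..M})"
    "\<And>x. x \<in> {0..M} \<Longrightarrow> (v' has_vector_derivative v'' x) (at x within {0..M})"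
    "\<And>x. x \<in> {0..M} \<Longrightarrow> - v'' x + of_real (V x) * v x - z * v x = 0"
    unfolding solves_ivp_def by blast
  have v'': "v'' x = (q x - (z - E)) * v x" if "x \<in> {0..M}" for x
    using v(3)[OF that] by (simp add: q algebra_simps)
  obtain L where L: "\<And>x. x \<in> {0..M} \<Longrightarrow> \<bar>q x\<bar> \<le> L"
  proof -
    have "compact (q ` {0..M})"
      by (intro compact_continuous_image continuous_on_subset[OF cont_q]) auto
    thus ?thesis using that by (fastforce dest!: compact_imp_bounded simp: bounded_iff)
  qed
  have "L \<ge> 0" using L[of 0] \<open>M \<ge> 0\<close> by auto
  have "v M - sol (z - E) M = 0 \<and> v' M - sol' (z - E) M = 0"
  proof (rule ode_zero[where a = 0 and b = M and x = M and ?x0.0 = 0 and K = "L + cmod (z - E)"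
        and u = "\<lambda>x. v x - sol (z - E) x" and u' = "\<lambda>x. v' x - sol' (z - E) x"
        and u'' = "\<lambda>x. v'' x - (q x - (z - E)) * sol (z - E) x"])
    fix x assume x: "x \<in> {0..M}"
    show "((\<lambda>x. v x - sol (z - E) x) has_vector_derivative v' x - sol' (z - E) x) (at x within {0..M})"
      "((\<lambda>x. v' x - sol' (z - E) x) has_vector_derivative v'' x - (q x - (z - E)) * sol (z - E) x)
          (at x within {0..M})"
      by (intro has_vector_derivative_diff v sol_deriv x)+
    have "v'' x - (q x - (z - E)) * sol (z - E) x = (q x - (z - E)) * (v x - sol (z - E) x)"
      by (simp add: v''[OF x] algebra_simps)
    moreover have "cmod (of_real (q x) - (z - E)) \<le> L + cmod (z - E)"
      using norm_triangle_ineq4[of "of_real (q x)" "z - E"] L[OF x] by simp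
    ultimately show "cmod (v'' x - (q x - (z - E)) * sol (z - E) x) \<le>
        (L + cmod (z - E)) * cmod (v x - sol (z - E) x)"
      by (simp add: norm_mult mult_right_mono)
  next
    show "v 0 - sol (z - E) 0 = 0" "v' 0 - sol' (z - E) 0 = 0"
      using ivp init by (auto simp: solves_ivp_def sol_0 split: if_splits)
  qed (use \<open>L \<ge> 0\<close> \<open>M \<ge> 0\<close> in auto)
  thus ?thesis by (simp add: Theta_def pair)
qed

section \<open>Lower bound for the derivative of \<Theta> at E\<close>

lemma primitive_u2_pos: "primitive (\<lambda>t. (u t)\<^sup>2) 1 > 0"
  and primitive_u2_mono: "x \<le> y \<Longrightarrow> primitive (\<lambda>t. (u t)\<^sup>2) x \<le> primitive (\<lambda>t. (u t)\<^sup>2) y"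
proof -
  define S where "S = primitive (\<lambda>t. (u t)\<^sup>2)"
  have S: "(S has_real_derivative (u x)\<^sup>2) (at x)" for x
    unfolding S_def by (intro primitive_deriv continuous_intros continuous_pair)
  have mono: "S x \<le> S y" if "x \<le> y" for x y
    using that by (rule DERIV_nonneg_imp_nondecreasing) (use S in fastforce)
  thus "x \<le> y \<Longrightarrow> primitive (\<lambda>t. (u t)\<^sup>2) x \<le> primitive (\<lambda>t. (u t)\<^sup>2) y" by (simp add: S_def)
  show "primitive (\<lambda>t. (u t)\<^sup>2) 1 > 0"
  proof (rule ccontr)
    assume "\<not> ?thesis"
    hence "S 1 \<le> 0" by (simp add: S_def)
    \<comment> \<open>Monotonicity squeezes S to 0 on (0, 1). Then u vanishes there and u' vanishes
      at 1/2, which contradicts the Wronskian 1.\<close>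
    hence S_0: "S x = 0" if "x \<in> {0<..<1}" for x
      using mono[of 0 x] mono[of x 1] that by (simp add: S_def)
    have u_0: "u x = 0" if x: "x \<in> {0<..<1}" for x
    proof -
      have "(S has_real_derivative 0) (at x)"
        by (rule has_field_derivative_transform_within_open[of "\<lambda>_. 0" _ _ "{0<..<1}"])
           (use x S_0 in auto)
      from DERIV_unique[OF this S] show ?thesis by simp
    qed
    have "(u has_real_derivative 0) (at (1/2))"
      by (rule has_field_derivative_transform_within_open[of "\<lambda>_. 0" _ _ "{0<..<1}"])
         (use u_0 in auto)
    from DERIV_unique[OF this deriv_u] have "u' (1/2) = 0" by simp
    thus False using wronskian[of "1/2"] u_0[of "1/2"] by simp
  qed
qed

text \<open>The Wronskian of \<open>u\<close> and \<open>\<partial>\<^sub>z u\<close> is \<open>- \<integral> u\<^sup>2\<close>, so \<open>\<partial>\<^sub>z u\<close> must grow as fast as \<open>u\<close> decays.\<close>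

lemma deriv_lower_bound:
  fixes s :: real
  assumes "s > 0"
  defines "D \<equiv> \<lambda>M. complex_of_real (taylor' 1 M) - \<i> * (of_real (u M) / (2 * of_real s) + of_real s * of_real (taylor 1 M))"
  obtains c where "c > 0" "\<forall>\<^sub>F M in at_top. c * exp (\<kappa> * M) \<le> cmod (D M)"
proof -
  define I where "I = primitive (\<lambda>t. (u t)\<^sup>2) 1"
  have "I > 0" using primitive_u2_pos by (simp add: I_def)
  have "A > 0" using A_ge_1 by simp
  \<comment> \<open>\<open>I\<close> bounds the integral of u^2 from below for M >= 1. The factor 2
    pays for absorbing the error A^2 / (2 s^2) into half of exp(\<kappa> M) I, which is possible for
    large M.\<close>
  define c where "c = I / (2 * A * (1 + 1 / s))"
  have "1 + 1 / s > 0" using \<open>s > 0\<close> by (simp add: add_pos_pos)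
  have "c > 0" using \<open>I > 0\<close> \<open>A > 0\<close> \<open>1 + 1 / s > 0\<close> by (simp add: c_def)
  have "filterlim (\<lambda>M. exp (\<kappa> * M)) at_top at_top" using \<kappa>_pos by real_asymp
  hence "\<forall>\<^sub>F M in at_top. A\<^sup>2 / (s\<^sup>2 * I) \<le> exp (\<kappa> * M)" by (simp add: filterlim_at_top)
  hence "\<forall>\<^sub>F M in at_top. c * exp (\<kappa> * M) \<le> cmod (D M)"
    using eventually_ge_at_top[of 1]
  proof eventually_elim
    case (elim M)
    hence "M \<ge> 0" by simp
    define d where "d = cmod (D M)"
    \<comment> \<open>All coefficients are real, so \<open>taylor' 1 M\<close> and -X are the real
      and imaginary parts of \<open>D M\<close>. Hence |D M| controls \<open>taylor' 1 M\<close>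
      and, up to the bounded term in u, also \<open>taylor 1 M\<close>.\<close>
    define X where "X = u M / (2 * s) + s * taylor 1 M"
    have "D M = of_real (taylor' 1 M) - \<i> * of_real X"
      unfolding D_def X_def of_real_add of_real_mult of_real_divide of_real_numeral ..
    hence y': "\<bar>taylor' 1 M\<bar> \<le> d" and "\<bar>X\<bar> \<le> d"
      using abs_Re_le_cmod[of "D M"] abs_Im_le_cmod[of "D M"]
      by (simp_all add: d_def del: taylor'.simps taylor.simps One_nat_def)
    hence "\<bar>s * taylor 1 M\<bar> \<le> d + \<bar>u M / (2 * s)\<bar>" unfolding X_def by linarith
    also have "\<bar>u M / (2 * s)\<bar> = \<bar>u M\<bar> / (2 * s)" using \<open>s > 0\<close> by simp
    also have "\<bar>u M\<bar> \<le> A * exp (- \<kappa> * M)" by (rule u_le[OF \<open>M \<ge> 0\<close>])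
    also have "\<dots> \<le> A * 1" using \<kappa>_pos \<open>M \<ge> 0\<close> \<open>A > 0\<close> by (intro mult_left_mono) auto
    finally have "s * \<bar>taylor 1 M\<bar> \<le> d + A / (2 * s)"
      using \<open>s > 0\<close> by (simp add: abs_mult divide_right_mono)
    hence y: "\<bar>taylor 1 M\<bar> \<le> (d + A / (2 * s)) / s"
      using \<open>s > 0\<close> by (simp add: pos_le_divide_eq mult.commute)
    have "I \<le> primitive (\<lambda>t. (u t)\<^sup>2) M"
      unfolding I_def using elim by (intro primitive_u2_mono)
    also have "\<dots> \<le> \<bar>u M * taylor' 1 M\<bar> + \<bar>u' M * taylor 1 M\<bar>"
      using taylor_1_wronskian[of M] by linarith
    also have "\<dots> \<le> A * exp (- \<kappa> * M) * d + A * exp (- \<kappa> * M) * ((d + A / (2 * s)) / s)"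
      unfolding abs_mult using u_le[OF \<open>M \<ge> 0\<close>] u'_le[OF \<open>M \<ge> 0\<close>] y y' \<open>A > 0\<close>
      by (intro add_mono mult_mono) auto
    also have "\<dots> = exp (- \<kappa> * M) * (A * (1 + 1 / s) * d + A\<^sup>2 / (2 * s\<^sup>2))"
      using \<open>s > 0\<close> by (simp add: field_simps power2_eq_square)
    finally have "exp (\<kappa> * M) * I \<le> exp (\<kappa> * M) * (exp (- \<kappa> * M) * (A * (1 + 1 / s) * d + A\<^sup>2 / (2 * s\<^sup>2)))"
      by (intro mult_left_mono) auto
    also have "\<dots> = (exp (\<kappa> * M) * exp (- \<kappa> * M)) * (A * (1 + 1 / s) * d + A\<^sup>2 / (2 * s\<^sup>2))"
      by (simp only: mult.assoc)
    also have "exp (\<kappa> * M) * exp (- \<kappa> * M) = 1" by (simp flip: exp_add)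
    finally have "exp (\<kappa> * M) * I \<le> A * (1 + 1 / s) * d + A\<^sup>2 / (2 * s\<^sup>2)" by simp
    moreover have "A\<^sup>2 / (2 * s\<^sup>2) \<le> exp (\<kappa> * M) * I / 2"
      using elim(1) \<open>I > 0\<close> \<open>s > 0\<close> by (simp add: field_simps)
    ultimately have "exp (\<kappa> * M) * I \<le> 2 * (A * (1 + 1 / s) * d)" by simp
    thus "c * exp (\<kappa> * M) \<le> cmod (D M)"
      using \<open>A > 0\<close> \<open>1 + 1 / s > 0\<close> by (simp add: c_def d_def[symmetric] pos_divide_le_eq mult_ac)
  qed
  thus ?thesis using \<open>c > 0\<close> that by blast
qed

end

section \<open>The Newton step\<close>

text \<open>The zeros of f are the fixed points of N z = z - f z / D, which has Lipschitz constant c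
  t on the ball of radius t about \<open>z0\<close>. On the full ball N is a contraction by 1/2 into
  itself. A zero lies within 2 |f z0 / D| of \<open>z0\<close>; using the Lipschitz bound on the
  ball with that zero on its boundary makes the error of the first step quadratic.\<close>

lemma ex1_zero_newton:
  fixes f f' :: "complex \<Rightarrow> complex"
  assumes f: "\<And>z. z \<in> cball z0 r \<Longrightarrow> (f has_field_derivative f' z) (at z)"
    and lip: "\<And>z. z \<in> cball z0 r \<Longrightarrow> cmod (f' z - D) \<le> c * cmod D * cmod (z - z0)"
    and "D \<noteq> 0" "r > 0" "0 \<le> c" "c * r \<le> 1 / 2" "cmod (f z0 / D) \<le> r / 2"
  shows "\<exists>!z. z \<in> cball z0 r \<and> f z = 0"
    and "\<And>z. z \<in> cball z0 r \<Longrightarrow> f z = 0 \<Longrightarrow> cmod (z - (z0 - f z0 / D)) \<le> 4 * c * (cmod (f z0 / D))\<^sup>2"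
proof -
  define N where "N z = z - f z / D" for z
  have N_lip: "cmod (N x - N y) \<le> c * t * cmod (x - y)"
    if "t \<le> r" "x \<in> cball z0 t" "y \<in> cball z0 t" for x y t
  proof (rule field_differentiable_bound[OF convex_cball _ _ that(2,3)])
    fix z assume z: "z \<in> cball z0 t"
    hence zr: "z \<in> cball z0 r" using that(1) by auto
    show "(N has_field_derivative 1 - f' z / D) (at z within cball z0 t)"
      unfolding N_def using \<open>D \<noteq> 0\<close>
      by (auto intro!: derivative_eq_intros has_field_derivative_at_within[OF f[OF zr]])
    have "cmod (1 - f' z / D) = cmod (f' z - D) / cmod D"
      using \<open>D \<noteq> 0\<close> by (simp add: norm_minus_commute diff_divide_distrib flip: norm_divide)
    also have "\<dots> \<le> c * cmod (z - z0)"
      using lip[OF zr] \<open>D \<noteq> 0\<close> by (simp add: divide_simps mult_ac)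
    also have "\<dots> \<le> c * t"
      using z \<open>0 \<le> c\<close> by (intro mult_left_mono) (auto simp: dist_norm norm_minus_commute)
    finally show "cmod (1 - f' z / D) \<le> c * t" .
  qed
  have half: "cmod (N x - N y) \<le> 1 / 2 * cmod (x - y)" if "x \<in> cball z0 r" "y \<in> cball z0 r" for x y
    using N_lip[OF order_refl that] mult_right_mono[OF \<open>c * r \<le> 1 / 2\<close>, of "cmod (x - y)"] by simp
  have N_z0: "cmod (N z0 - z0) = cmod (f z0 / D)" by (simp add: N_def)
  have "\<exists>!z\<in>cball z0 r. N z = z"
  proof (rule Banach_fix)
    show "N ` cball z0 r \<subseteq> cball z0 r"
    proof safe
      fix z assume z: "z \<in> cball z0 r"
      have "cmod (N z - z0) \<le> cmod (N z - N z0) + cmod (N z0 - z0)"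
        by (rule norm_diff_triangle_ineq[of "N z" "N z0" "N z0" z0, simplified]) 
      also have "\<dots> \<le> 1 / 2 * cmod (z - z0) + r / 2"
        using half[OF z, of z0] \<open>r > 0\<close> assms(7) N_z0 by (intro add_mono) auto
      also have "\<dots> \<le> r" using z by (simp add: dist_norm norm_minus_commute)
      finally show "N z \<in> cball z0 r" by (simp add: dist_norm norm_minus_commute)
    qed
    show "dist (N x) (N y) \<le> 1 / 2 * dist x y" if "x \<in> cball z0 r" "y \<in> cball z0 r" for x y
      using half[OF that] by (simp add: dist_norm)
  qed (use \<open>r > 0\<close> in \<open>auto simp: complete_eq_closed\<close>)
  moreover have N_fix: "N z = z \<longleftrightarrow> f z = 0" for z using \<open>D \<noteq> 0\<close> by (simp add: N_def)
  ultimately show "\<exists>!z. z \<in> cball z0 r \<and> f z = 0" by auto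
  show "cmod (z - (z0 - f z0 / D)) \<le> 4 * c * (cmod (f z0 / D))\<^sup>2"
    if z: "z \<in> cball z0 r" "f z = 0" for z
  proof -
    define t where "t = cmod (z - z0)"
    have t: "t \<ge> 0" "t \<le> r" using z by (auto simp: t_def dist_norm norm_minus_commute)
    have "t = cmod ((N z - N z0) + (N z0 - z0))" using N_fix[of z] z(2) by (simp add: t_def)
    also have "\<dots> \<le> cmod (N z - N z0) + cmod (N z0 - z0)" by (rule norm_triangle_ineq)
    also have "\<dots> \<le> 1 / 2 * t + cmod (f z0 / D)"
      using half[OF z(1), of z0] \<open>r > 0\<close> N_z0 by (simp add: t_def)
    finally have t_le: "t \<le> 2 * cmod (f z0 / D)" by simp
    have "cmod (z - (z0 - f z0 / D)) = cmod (N z - N z0)"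
      using N_fix z by (simp add: N_def)
    also have "\<dots> \<le> c * t * t"
      using N_lip[of t z z0] t unfolding t_def by (auto simp: dist_norm norm_minus_commute)
    also have "\<dots> \<le> c * (2 * cmod (f z0 / D)) * (2 * cmod (f z0 / D))"
      using t_le t \<open>0 \<le> c\<close> by (intro mult_mono) auto
    finally show ?thesis by (simp add: power2_eq_square mult_ac)
  qed
qed

section \<open>The square root near E and Lipschitz bounds for the derivative of \<Theta>\<close>

lemma csqrt_near_positive:
  fixes s :: real
  assumes "s > 0" and z: "cmod (z - (complex_of_real s)\<^sup>2) \<le> s\<^sup>2 / 2"
  shows "cmod (csqrt z - s) \<le> cmod (z - (complex_of_real s)\<^sup>2) / s" "s / 2 \<le> cmod (csqrt z)"
    "cmod (csqrt z) \<le> 2 * s" "z \<notin> \<real>\<^sub>\<le>\<^sub>0"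
proof -
  have Re: "Re (csqrt z) \<ge> 0" using Re_csqrt by simp
  \<comment> \<open>In the factorization z - s^2 = (csqrt z - s) (csqrt z + s) the second factor has
    modulus at least s, because the principal root has nonnegative real part.\<close>
  have "s \<le> Re (csqrt z + s)" using Re by simp
  also have "\<dots> \<le> cmod (csqrt z + s)" by (rule complex_Re_le_cmod)
  finally have "cmod (csqrt z - s) * s \<le> cmod (csqrt z - s) * cmod (csqrt z + s)"
    by (intro mult_left_mono) auto
  also have "\<dots> = cmod (z - (complex_of_real s)\<^sup>2)"
    by (simp add: algebra_simps power2_csqrt[unfolded power2_eq_square] power2_eq_square flip: norm_mult)
  finally show le: "cmod (csqrt z - s) \<le> cmod (z - (complex_of_real s)\<^sup>2) / s"
    using \<open>s > 0\<close> by (simp add: field_simps)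
  also have "\<dots> \<le> s\<^sup>2 / 2 / s" using z \<open>s > 0\<close> by (intro divide_right_mono) auto
  also have "\<dots> = s / 2" using \<open>s > 0\<close> by (simp add: power2_eq_square)
  finally have half: "cmod (csqrt z - s) \<le> s / 2" .
  show "s / 2 \<le> cmod (csqrt z)" "cmod (csqrt z) \<le> 2 * s"
    using half \<open>s > 0\<close> norm_triangle_ineq3[of "csqrt z" "complex_of_real s"] by (auto simp: abs_le_iff)
  have "s\<^sup>2 - Re z \<le> cmod (z - (complex_of_real s)\<^sup>2)"
    using abs_Re_le_cmod[of "z - (complex_of_real s)\<^sup>2"] by (simp flip: of_real_power)
  moreover have "s\<^sup>2 > 0" using \<open>s > 0\<close> by simp
  ultimately have "Re z > 0" using z by linarith
  thus "z \<notin> \<real>\<^sub>\<le>\<^sub>0" by (auto simp: complex_nonpos_Reals_iff)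
qed

text \<open>F is \<Theta> for fixed M, with a and b the coefficients of the derivative and of the
  value at M, and D is its derivative at E = s^2. The condition \<beta> |z - s^2| <= 1 keeps the
  exponential majorants bounded, so that the constant depends on s only, apart from K
  \<beta>^2.\<close>

lemma series_csqrt_deriv_lipschitz:
  fixes a b :: "nat \<Rightarrow> complex" and s :: real
  defines "F \<equiv> \<lambda>z::complex. (\<Sum>n. a n * (z - (of_real s)\<^sup>2) ^ n) - \<i> * csqrt z * (\<Sum>n. b n * (z - (of_real s)\<^sup>2) ^ n)"
  defines "D \<equiv> a 1 - \<i> * (b 0 / (2 * of_real s) + of_real s * b 1)"
  assumes a: "\<And>n. cmod (a n) \<le> K * \<beta> ^ n / fact n"
    and b: "\<And>n. cmod (b n) \<le> K * \<beta> ^ n / fact n"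
    and "\<beta> \<ge> 1" "s > 0"
  obtains F' where "F' ((of_real s)\<^sup>2) = D"
    and "\<And>z. cmod (z - (of_real s)\<^sup>2) \<le> s\<^sup>2 / 2 \<Longrightarrow> (F has_field_derivative F' z) (at z)"
    and "\<And>z. cmod (z - (of_real s)\<^sup>2) \<le> s\<^sup>2 / 2 \<Longrightarrow> \<beta> * cmod (z - (of_real s)\<^sup>2) \<le> 1 \<Longrightarrow>
      cmod (F' z - D) \<le> (3 + 4 / s + 1 / s ^ 3 + 6 * s) * (K * \<beta>\<^sup>2) * cmod (z - (of_real s)\<^sup>2)"
proof -
  define P Q P' Q' where "P \<zeta> = (\<Sum>n. a n * \<zeta> ^ n)" and "Q \<zeta> = (\<Sum>n. b n * \<zeta> ^ n)"
    and "P' \<zeta> = (\<Sum>n. diffs a n * \<zeta> ^ n)" and "Q' \<zeta> = (\<Sum>n. diffs b n * \<zeta> ^ n)" for \<zeta>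
  define F' where "F' z = P' (z - (of_real s)\<^sup>2) - \<i> * (Q (z - (of_real s)\<^sup>2) / (2 * csqrt z) + csqrt z * Q' (z - (of_real s)\<^sup>2))" for z
  have "\<beta> \<ge> 0" using \<open>\<beta> \<ge> 1\<close> by simp
  have "K \<ge> 0" using order_trans[OF norm_ge_zero a[of 0]] by simp
  note A = exp_type_series[OF a \<open>\<beta> \<ge> 0\<close>] and B = exp_type_series[OF b \<open>\<beta> \<ge> 0\<close>]
  note A' = exp_type_series[of "diffs a", OF A(4) \<open>\<beta> \<ge> 0\<close>]
    and B' = exp_type_series[of "diffs b", OF B(4) \<open>\<beta> \<ge> 0\<close>]
  have at_0: "Q 0 = b 0" "P' 0 = a 1" "Q' 0 = b 1"
    by (simp_all add: Q_def P'_def Q'_def diffs_def)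
  have F'_s: "F' ((of_real s)\<^sup>2) = D"
    using \<open>s > 0\<close> by (simp add: F'_def D_def at_0 flip: of_real_power)
  have deriv: "(F has_field_derivative F' z) (at z)" if "cmod (z - (of_real s)\<^sup>2) \<le> s\<^sup>2 / 2" for z
  proof -
    have P: "((\<lambda>z. P (z - (of_real s)\<^sup>2)) has_field_derivative P' (z - (of_real s)\<^sup>2) * 1) (at z)"
      by (rule DERIV_chain2[of P]) (auto intro!: derivative_eq_intros A(3) simp: P_def[abs_def] P'_def)
    have Q: "((\<lambda>z. Q (z - (of_real s)\<^sup>2)) has_field_derivative Q' (z - (of_real s)\<^sup>2) * 1) (at z)"
      by (rule DERIV_chain2[of Q]) (auto intro!: derivative_eq_intros B(3) simp: Q_def[abs_def] Q'_def)
    have "F = (\<lambda>z. P (z - (of_real s)\<^sup>2) - \<i> * csqrt z * Q (z - (of_real s)\<^sup>2))"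
      by (simp add: F_def P_def Q_def)
    moreover have "z \<notin> \<real>\<^sub>\<le>\<^sub>0" using csqrt_near_positive(4)[OF \<open>s > 0\<close>] that by simp
    ultimately show ?thesis
      using P Q by (auto intro!: derivative_eq_intros simp: F'_def algebra_simps)
  qed
  have bound: "cmod (F' z - D) \<le> (3 + 4 / s + 1 / s ^ 3 + 6 * s) * (K * \<beta>\<^sup>2) * cmod (z - (of_real s)\<^sup>2)"
    if z: "cmod (z - (of_real s)\<^sup>2) \<le> s\<^sup>2 / 2" "\<beta> * cmod (z - (of_real s)\<^sup>2) \<le> 1" for z
  proof -
    define \<zeta> r g where "\<zeta> = z - (complex_of_real s)\<^sup>2" and "r = cmod \<zeta>" and "g = csqrt z"
    have g: "cmod (g - s) \<le> r / s" "s / 2 \<le> cmod g" "cmod g \<le> 2 * s"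
      using csqrt_near_positive[OF \<open>s > 0\<close>, of z] z by (auto simp: \<zeta>_def r_def g_def)
    have "g \<noteq> 0" using g \<open>s > 0\<close> by auto
    have "r \<ge> 0" by (simp add: r_def)
    have "exp (\<beta> * r) \<le> exp 1" using z by (simp add: r_def \<zeta>_def)
    also have "\<dots> \<le> 3" by (rule exp_le)
    finally have exp3: "exp (\<beta> * r) \<le> 3" .
    have scale: "c * exp (\<beta> * cmod \<zeta>) * cmod \<zeta> \<le> 3 * c * r" if "c \<ge> 0" for c
      using mult_right_mono[OF mult_left_mono[OF exp3 that] \<open>r \<ge> 0\<close>] by (simp add: r_def mult_ac)
    \<comment> \<open>As \<beta> >= 1, all terms can share the largest prefactor K
      \<beta>^2.\<close>
    have KB: "K * \<beta> \<le> K * \<beta>\<^sup>2" "K \<le> K * \<beta>\<^sup>2"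
      using \<open>\<beta> \<ge> 1\<close> \<open>K \<ge> 0\<close> by (auto simp: power2_eq_square mult_le_cancel_left1 mult_le_cancel_left2
          intro!: mult_left_mono mult_ge1_I[of \<beta> \<beta>, simplified] mult_le_one)
    have Q: "cmod (Q \<zeta> - b 0) \<le> 3 * (K * \<beta>\<^sup>2) * r"
      using B(5)[of \<zeta>] scale[of "K * \<beta>"] KB(1) \<open>K \<ge> 0\<close> \<open>\<beta> \<ge> 0\<close> mult_right_mono[OF KB(1) \<open>r \<ge> 0\<close>]
      by (simp add: Q_def)
    have P': "cmod (P' \<zeta> - a 1) \<le> 3 * (K * \<beta>\<^sup>2) * r"
      using A'(5)[of \<zeta>] scale[of "K * \<beta> * \<beta>"] \<open>K \<ge> 0\<close> \<open>\<beta> \<ge> 0\<close>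
      by (simp add: P'_def power2_eq_square mult.assoc diffs_def)
    have Q': "cmod (Q' \<zeta> - b 1) \<le> 3 * (K * \<beta>\<^sup>2) * r"
      using B'(5)[of \<zeta>] scale[of "K * \<beta> * \<beta>"] \<open>K \<ge> 0\<close> \<open>\<beta> \<ge> 0\<close>
      by (simp add: Q'_def power2_eq_square mult.assoc diffs_def)
    have b0: "cmod (b 0) \<le> K * \<beta>\<^sup>2" using b[of 0] KB(2) by simp
    have b1: "cmod (b 1) \<le> K * \<beta>\<^sup>2" using b[of 1] KB(1) by simp
    have inv_diff: "cmod (1 / (2 * g) - 1 / (2 * s)) \<le> r / s ^ 3"
    proof -
      have "cmod (1 / (2 * g) - 1 / (2 * s)) = cmod ((s - g) / (2 * g * s))"
        using \<open>g \<noteq> 0\<close> \<open>s > 0\<close> by (simp add: field_simps)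
      also have "\<dots> = cmod (g - s) / (2 * cmod g * s)"
        using \<open>s > 0\<close> by (simp add: norm_divide norm_mult norm_minus_commute)
      also have "\<dots> \<le> (r / s) / (2 * (s / 2) * s)"
        using g \<open>s > 0\<close> \<open>r \<ge> 0\<close> by (intro frac_le mult_mono) auto
      finally show ?thesis by (simp add: power3_eq_cube)
    qed
    have inv_g: "cmod (1 / (2 * g)) \<le> 1 / s"
      using g(2) \<open>s > 0\<close> by (simp add: norm_divide norm_mult divide_simps)
    define KB where "KB = K * \<beta>\<^sup>2"
    have "KB \<ge> 0" using \<open>K \<ge> 0\<close> by (simp add: KB_def)
    note bnds = Q[folded KB_def] P'[folded KB_def] Q'[folded KB_def] b0[folded KB_def] b1[folded KB_def]
    have t1: "cmod ((Q \<zeta> - b 0) * (1 / (2 * g))) \<le> 3 * KB * r * (1 / s)"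
      unfolding norm_mult[of "Q \<zeta> - b 0"] using bnds inv_g \<open>s > 0\<close> \<open>KB \<ge> 0\<close> \<open>r \<ge> 0\<close> by (intro mult_mono) auto
    have t2: "cmod (b 0 * (1 / (2 * g) - 1 / (2 * s))) \<le> KB * (r / s ^ 3)"
      unfolding norm_mult[of "b 0"] using bnds inv_diff \<open>s > 0\<close> \<open>KB \<ge> 0\<close> \<open>r \<ge> 0\<close> by (intro mult_mono) auto
    have t3: "cmod (g * (Q' \<zeta> - b 1)) \<le> 2 * s * (3 * KB * r)"
      unfolding norm_mult using bnds g \<open>s > 0\<close> \<open>KB \<ge> 0\<close> \<open>r \<ge> 0\<close> by (intro mult_mono) auto
    have t4: "cmod ((g - s) * b 1) \<le> r / s * KB"
      unfolding norm_mult using bnds g \<open>s > 0\<close> \<open>KB \<ge> 0\<close> \<open>r \<ge> 0\<close> by (intro mult_mono) auto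
    \<comment> \<open>Each product is split so that only one factor varies at a time. The variation
      of P' contributes 3, those of Q and of the square root multiplying b 1 together 4 / s, that of
      the inverse square root 1 / s^3, and that of Q' contributes 6 s.\<close>
    have "F' z - D = (P' \<zeta> - a 1) - \<i> * ((Q \<zeta> - b 0) * (1 / (2 * g)) + b 0 * (1 / (2 * g) - 1 / (2 * s))
        + g * (Q' \<zeta> - b 1) + (g - s) * b 1)"
      by (simp add: F'_def D_def \<zeta>_def g_def algebra_simps)
    also have "cmod \<dots> \<le> cmod (P' \<zeta> - a 1) + (cmod ((Q \<zeta> - b 0) * (1 / (2 * g))) +
        cmod (b 0 * (1 / (2 * g) - 1 / (2 * s))) + cmod (g * (Q' \<zeta> - b 1)) + cmod ((g - s) * b 1))"
      by (rule order_trans[OF norm_triangle_ineq4], rule add_left_mono)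
         (auto simp: norm_mult[of \<i>] intro!: norm_triangle_le add_mono)
    also have "\<dots> \<le> 3 * KB * r + (3 * KB * r * (1 / s) + KB * (r / s ^ 3) + 2 * s * (3 * KB * r) + r / s * KB)"
      using t1 t2 t3 t4 bnds(2) by (intro add_mono) auto
    also have "\<dots> = (3 + 4 / s + 1 / s ^ 3 + 6 * s) * KB * r"
      by (simp add: algebra_simps)
    finally show ?thesis by (simp add: KB_def r_def \<zeta>_def)
  qed
  show ?thesis
    using F'_s deriv bound by (rule that)
qed

text \<open>With k = \<kappa> / 2 the first Newton step is O(exp(-4 k M)), well below the radius
  exp(-k M) / M^2, and the relative Lipschitz constant of the derivative is O(M^2). The quadratic
  Newton error is therefore O(M^2 exp(-8 k M)), which is O(exp(-4 k M)).\<close>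

lemma (in solution_pair) Theta_root_asymptotics:
  fixes \<Phi> :: "real \<Rightarrow> complex" and E :: real
  assumes q: "q = (\<lambda>x. V x - E)" and "E > 0"
    and init: "if even_fun \<Phi> then u 0 = 1 \<and> u' 0 = 0 else u 0 = 0 \<and> u' 0 = 1"
  defines "k \<equiv> \<kappa> / 2"
  shows "\<exists>C. \<forall>\<^sub>F M in at_top.
           (\<exists>!z. Theta_root V \<Phi> E k M z) \<and>
           Theta V \<Phi> M field_differentiable (at (complex_of_real E)) \<and>
           deriv (Theta V \<Phi> M) (complex_of_real E) \<noteq> 0 \<and>
           (\<forall>z. Theta_root V \<Phi> E k M z \<longrightarrow>
              cmod (z - (complex_of_real E
                         - Theta V \<Phi> M (complex_of_real E)
                           / deriv (Theta V \<Phi> M) (complex_of_real E)))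
                \<le> C * exp (- 4 * k * M))"
proof -
  define s where "s = sqrt E"
  have "s > 0" and s2: "E = s\<^sup>2" using \<open>E > 0\<close> by (simp_all add: s_def)
  have cE: "complex_of_real E = (of_real s)\<^sup>2" by (simp add: s2)
  have "k > 0" using \<kappa>_pos by (simp add: k_def)
  have "A > 0" using A_ge_1 by simp
  define D where "D M = complex_of_real (taylor' 1 M) -
    \<i> * (of_real (u M) / (2 * of_real s) + of_real s * of_real (taylor 1 M))" for M
  obtain c where "c > 0" and D_ge: "\<forall>\<^sub>F M in at_top. c * exp (\<kappa> * M) \<le> cmod (D M)"
    using deriv_lower_bound[OF \<open>s > 0\<close>] unfolding D_def by blast
  define Cs where "Cs = 3 + 4 / s + 1 / s ^ 3 + 6 * s"
  have "Cs > 0" using \<open>s > 0\<close> by (simp add: Cs_def add_pos_pos)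
  \<comment> \<open>After division by the lower bound c exp(\<kappa> M) for the derivative, L M^2 is
    the relative Lipschitz constant and G exp(-4 k M) bounds the first Newton step.\<close>
  define L where "L = Cs * (A * (2 * A\<^sup>2)\<^sup>2) / c"
  define G where "G = A * (1 + s) / c"
  have "L \<ge> 0" "G \<ge> 0" using \<open>Cs > 0\<close> \<open>A > 0\<close> \<open>c > 0\<close> \<open>s > 0\<close> by (simp_all add: L_def G_def)
  define r where "r M = 1 / M\<^sup>2 * exp (- k * M)" for M
  have "((\<lambda>M. exp (- k * M)) \<longlongrightarrow> 0) at_top" "((\<lambda>M. M\<^sup>2 * exp (- (3 * k * M))) \<longlongrightarrow> 0) at_top"
    "((\<lambda>M. M * (1 / M\<^sup>2 * exp (- k * M))) \<longlongrightarrow> 0) at_top"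
    using \<open>k > 0\<close> by real_asymp+
  note lims = this(1)[THEN tendsto_mult_right_zero, of L] this(2)[THEN tendsto_mult_right_zero, of G]
    this(3)[THEN tendsto_mult_right_zero, of "2 * A\<^sup>2"]
  have "((\<lambda>M. 1 / M\<^sup>2 * exp (- k * M)) \<longlongrightarrow> 0) at_top" "((\<lambda>M. M\<^sup>2 * exp (- (4 * k * M))) \<longlongrightarrow> 0) at_top"
    using \<open>k > 0\<close> by real_asymp+
  note lims = lims this
  \<comment> \<open>In order: contraction by 1/2, a first step of at most half the radius, a ball
    inside the region where the square root is controlled, \<beta> r <= 1, and absorption of M^2 in
    the final error.\<close>
  have "\<forall>\<^sub>F M in at_top. L * exp (- k * M) < 1 / 2" "\<forall>\<^sub>F M in at_top. G * (M\<^sup>2 * exp (- (3 * k * M))) < 1 / 2"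
    "\<forall>\<^sub>F M in at_top. 1 / M\<^sup>2 * exp (- k * M) < s\<^sup>2 / 2"
    "\<forall>\<^sub>F M in at_top. 2 * A\<^sup>2 * (M * (1 / M\<^sup>2 * exp (- k * M))) < 1"
    "\<forall>\<^sub>F M in at_top. M\<^sup>2 * exp (- (4 * k * M)) < 1"
    by (rule lims[THEN order_tendstoD(2)]; use \<open>s > 0\<close> in simp)+
  hence "\<forall>\<^sub>F M in at_top.
      (\<exists>!z. Theta_root V \<Phi> E k M z) \<and>
      Theta V \<Phi> M field_differentiable (at (complex_of_real E)) \<and>
      deriv (Theta V \<Phi> M) (complex_of_real E) \<noteq> 0 \<and>
      (\<forall>z. Theta_root V \<Phi> E k M z \<longrightarrow>
         cmod (z - (complex_of_real E - Theta V \<Phi> M (complex_of_real E)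
                      / deriv (Theta V \<Phi> M) (complex_of_real E))) \<le> 4 * L * G\<^sup>2 * exp (- 4 * k * M))"
    using D_ge eventually_ge_at_top[of 1]
  proof eventually_elim
    case (elim M)
    have "M \<ge> 0" using elim by simp
    define \<beta> where "\<beta> = 2 * A\<^sup>2 * M"
    have "\<beta> \<ge> 1" 
      using mult_mono[of 1 "2 * A\<^sup>2" 1 M] one_le_power[OF A_ge_1, of 2] elim by (simp add: \<beta>_def)
    have r: "r M > 0" "r M \<le> s\<^sup>2 / 2" "\<beta> * r M \<le> 1"
      using elim by (simp_all add: r_def \<beta>_def)
    define F where "F = (\<lambda>z::complex. (\<Sum>n. of_real (taylor' n M) * (z - (of_real s)\<^sup>2) ^ n) -
        \<i> * csqrt z * (\<Sum>n. of_real (taylor n M) * (z - (of_real s)\<^sup>2) ^ n))"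
    have Theta_F: "Theta V \<Phi> M = F"
      using Theta_eq[OF q \<open>M \<ge> 0\<close> init] by (simp add: fun_eq_iff F_def sol_def sol'_def cE)
    obtain F' where F'_E: "F' ((of_real s)\<^sup>2) = D M"
      and F: "\<And>z. cmod (z - (of_real s)\<^sup>2) \<le> s\<^sup>2 / 2 \<Longrightarrow> (F has_field_derivative F' z) (at z)"
      and F'_lip: "\<And>z. cmod (z - (of_real s)\<^sup>2) \<le> s\<^sup>2 / 2 \<Longrightarrow> \<beta> * cmod (z - (of_real s)\<^sup>2) \<le> 1 \<Longrightarrow>
        cmod (F' z - D M) \<le> Cs * (A * exp (\<kappa> * M) * \<beta>\<^sup>2) * cmod (z - (of_real s)\<^sup>2)"
    proof (rule series_csqrt_deriv_lipschitz[of "\<lambda>n. of_real (taylor' n M)" "A * exp (\<kappa> * M)" \<beta>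
          "\<lambda>n. of_real (taylor n M)" s])
      show "cmod (of_real (taylor' n M)) \<le> A * exp (\<kappa> * M) * \<beta> ^ n / fact n"
        "cmod (of_real (taylor n M)) \<le> A * exp (\<kappa> * M) * \<beta> ^ n / fact n" for n
        using taylor_coeff_bound[OF \<open>M \<ge> 0\<close>] by (simp_all only: \<beta>_def)
    qed (use \<open>\<beta> \<ge> 1\<close> \<open>s > 0\<close> that in \<open>simp_all only: F_def D_def Cs_def taylor.simps(1)\<close>)
    have "D M \<noteq> 0" using elim \<open>c > 0\<close> by (metis exp_gt_zero mult_pos_pos norm_zero not_less)
    have cball: "z \<in> cball ((of_real s)\<^sup>2) (r M) \<longleftrightarrow> cmod (z - (of_real s)\<^sup>2) \<le> r M" for z :: complex
      by (simp add: dist_norm norm_minus_commute)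
    have lip: "cmod (F' z - D M) \<le> L * M\<^sup>2 * cmod (D M) * cmod (z - (of_real s)\<^sup>2)"
      if z: "z \<in> cball ((of_real s)\<^sup>2) (r M)" for z
    proof -
      have z': "cmod (z - (of_real s)\<^sup>2) \<le> r M" using z cball by blast
      have "\<beta> * cmod (z - (of_real s)\<^sup>2) \<le> \<beta> * r M"
        using z' \<open>\<beta> \<ge> 1\<close> by (intro mult_left_mono) auto
      hence "cmod (F' z - D M) \<le> Cs * (A * exp (\<kappa> * M) * \<beta>\<^sup>2) * cmod (z - (of_real s)\<^sup>2)"
        using z' r by (intro F'_lip) auto
      also have "Cs * (A * exp (\<kappa> * M) * \<beta>\<^sup>2) = L * M\<^sup>2 * (c * exp (\<kappa> * M))"
        using \<open>c > 0\<close> by (simp add: L_def \<beta>_def power_mult_distrib)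
      also have "L * M\<^sup>2 * (c * exp (\<kappa> * M)) * cmod (z - (of_real s)\<^sup>2) \<le>
          L * M\<^sup>2 * cmod (D M) * cmod (z - (of_real s)\<^sup>2)"
        using elim \<open>L \<ge> 0\<close> by (intro mult_right_mono mult_left_mono) auto
      finally show ?thesis .
    qed
    have quot: "cmod (F ((of_real s)\<^sup>2) / D M) \<le> G * exp (- (4 * k * M))"
    proof -
      have "F ((of_real s)\<^sup>2) = of_real (u' M) - \<i> * of_real s * of_real (u M)"
        using \<open>s > 0\<close> by (simp add: F_def flip: of_real_power)
      also have "cmod \<dots> \<le> \<bar>u' M\<bar> + s * \<bar>u M\<bar>"
        using \<open>s > 0\<close> by (intro order_trans[OF norm_triangle_ineq4]) (simp add: norm_mult)
      also have "\<dots> \<le> A * exp (- \<kappa> * M) + s * (A * exp (- \<kappa> * M))"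
        using \<open>s > 0\<close> u_le[OF \<open>M \<ge> 0\<close>] u'_le[OF \<open>M \<ge> 0\<close>] by (intro add_mono mult_left_mono) auto
      finally have "cmod (F ((of_real s)\<^sup>2)) \<le> A * (1 + s) * exp (- \<kappa> * M)" by (simp add: algebra_simps)
      hence "cmod (F ((of_real s)\<^sup>2) / D M) \<le> A * (1 + s) * exp (- \<kappa> * M) / (c * exp (\<kappa> * M))"
        unfolding norm_divide using elim \<open>c > 0\<close> \<open>A > 0\<close> \<open>s > 0\<close> by (intro frac_le) auto
      also have "\<dots> = G * (exp (- \<kappa> * M) / exp (\<kappa> * M))" by (simp add: G_def)
      also have "exp (- \<kappa> * M) / exp (\<kappa> * M) = exp (- (4 * k * M))"
        by (simp add: k_def flip: exp_diff)
      finally show ?thesis .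
    qed
    have M_exp: "exp (- (4 * k * M)) = M\<^sup>2 * exp (- (3 * k * M)) * r M"
      using elim by (simp add: r_def flip: exp_add)
    have "cmod (F ((of_real s)\<^sup>2) / D M) \<le> G * (M\<^sup>2 * exp (- (3 * k * M))) * r M"
      using quot unfolding M_exp by (simp add: mult.assoc)
    also have "\<dots> \<le> 1 / 2 * r M"
      using elim r by (intro mult_right_mono) auto
    finally have quot_half: "cmod (F ((of_real s)\<^sup>2) / D M) \<le> r M / 2" by simp
    have Lr: "L * M\<^sup>2 * r M \<le> 1 / 2"
      using elim by (simp add: r_def)
    have deriv_cball: "(F has_field_derivative F' z) (at z)" if "z \<in> cball ((of_real s)\<^sup>2) (r M)" for z
      using F[of z] that r unfolding cball by simp
    have "0 \<le> L * M\<^sup>2" using \<open>L \<ge> 0\<close> by simp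
    note newton = ex1_zero_newton[OF deriv_cball lip \<open>D M \<noteq> 0\<close> r(1) \<open>0 \<le> L * M\<^sup>2\<close> Lr quot_half]
    have root_iff: "Theta_root V \<Phi> E k M z \<longleftrightarrow> z \<in> cball ((of_real s)\<^sup>2) (r M) \<and> F z = 0" for z
    proof -
      have "z \<in> Theta_dom" if "cmod (z - (of_real s)\<^sup>2) \<le> r M"
        using csqrt_near_positive(4)[OF \<open>s > 0\<close>, of z] that r by (simp add: Theta_dom_def)
      moreover have "z \<in> Omega E k M \<longleftrightarrow> cmod (z - (of_real s)\<^sup>2) \<le> r M"
        by (simp add: Omega_def cE r_def)
      ultimately show ?thesis unfolding Theta_root_def Theta_F using cball[of z] by blast
    qed
    have deriv_E: "(F has_field_derivative D M) (at (complex_of_real E))"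
      using F[of "(of_real s)\<^sup>2"] F'_E by (simp add: cE)
    hence deriv_eq: "deriv F (complex_of_real E) = D M" by (rule DERIV_imp_deriv)
    have "cmod (z - (complex_of_real E - F (complex_of_real E) / D M)) \<le> 4 * L * G\<^sup>2 * exp (- 4 * k * M)"
      if z: "z \<in> cball ((of_real s)\<^sup>2) (r M)" "F z = 0" for z
    proof -
      have "cmod (z - (complex_of_real E - F (complex_of_real E) / D M)) \<le>
          4 * (L * M\<^sup>2) * (cmod (F ((of_real s)\<^sup>2) / D M))\<^sup>2"
        unfolding cE by (rule newton(2)) (use z in auto)
      also have "\<dots> \<le> 4 * (L * M\<^sup>2) * (G * exp (- (4 * k * M)))\<^sup>2"
        using quot \<open>0 \<le> L * M\<^sup>2\<close> by (intro mult_left_mono power_mono) auto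
      also have "\<dots> = 4 * L * G\<^sup>2 * exp (- (4 * k * M)) * (M\<^sup>2 * exp (- (4 * k * M)))"
        by (simp add: power_mult_distrib power2_eq_square)
      also have "\<dots> \<le> 4 * L * G\<^sup>2 * exp (- (4 * k * M)) * 1"
        using elim \<open>L \<ge> 0\<close> by (intro mult_left_mono) auto
      finally show ?thesis by simp
    qed
    moreover have "\<exists>!z. z \<in> cball ((of_real s)\<^sup>2) (r M) \<and> F z = 0"
      by (rule newton(1))
    ultimately show ?case
      unfolding root_iff Theta_F deriv_eq
      using deriv_E \<open>D M \<noteq> 0\<close> by (auto simp: field_differentiable_def)
  qed
  thus ?thesis by blast
qed

section \<open>The bound state\<close>

lemma has_ac_derivative_integral:
  assumes "has_ac_derivative f g" "a \<le> b"
  shows "g integrable_on {a..b}" "f b - f a = integral {a..b} g"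
  using assms set_borel_integral_eq_integral[of "{a..b}" g] by (auto simp: has_ac_derivative_def)

lemma has_ac_derivative_continuous:
  assumes "has_ac_derivative f g"
  shows "continuous_on UNIV f"
proof -
  have "isCont f x" for x
  proof -
    have cont: "continuous_on {x-1..x+1} (\<lambda>y. f (x - 1) + integral {x-1..y} g)"
      using has_ac_derivative_integral(1)[OF assms, of "x - 1" "x + 1"]
      by (intro continuous_intros indefinite_integral_continuous_1) auto
    have "f (x - 1) + integral {x-1..y} g = f y" if "y \<in> {x-1..x+1}" for y
      using has_ac_derivative_integral(2)[OF assms, of "x - 1" y] that by (simp add: diff_eq_eq add.commute)
    with cont have "continuous_on {x-1..x+1} f"
      by (rule continuous_on_eq)
    thus ?thesis
      by (rule continuous_on_interior) auto
  qed
  thus ?thesis by (simp add: continuous_on_eq_continuous_at)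
qed

text \<open>Changing g on a null set does not affect its integrals, so f is an indefinite integral
  of the continuous h and the fundamental theorem applies.\<close>

lemma has_ac_derivative_C1:
  assumes fg: "has_ac_derivative f g" and h: "continuous_on UNIV h"
    and AE: "AE x in lborel. g x = h x"
  shows "(f has_vector_derivative h x) (at x)"
proof -
  obtain N where N: "{x. g x \<noteq> h x} \<subseteq> N" "emeasure lborel N = 0" "N \<in> sets lborel"
    using AE by (rule AE_E) simp
  hence "negligible N"
    by (auto simp: negligible_iff_null_sets null_sets_def intro: null_sets_completionI)
  have eq: "f y = f (x - 1) + integral {x-1..y} h" if "y \<in> {x-1..x+1}" for y
  proof -
    have "integral {x-1..y} g = integral {x-1..y} h"
    proof (rule integral_spike[OF \<open>negligible N\<close>])
      show "h t = g t" if "t \<in> {x-1..y} - N" for t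
        using subsetD[OF N(1), of t] that by fastforce
    qed
    thus ?thesis using has_ac_derivative_integral(2)[OF fg, of "x - 1" y] that by (simp add: diff_eq_eq add.commute)
  qed
  have "((\<lambda>y. f (x - 1) + integral {x-1..y} h) has_vector_derivative 0 + h x) (at x within {x-1..x+1})"
    by (intro has_vector_derivative_add has_vector_derivative_const integral_has_vector_derivative
        continuous_on_subset[OF h]) auto
  hence "(f has_vector_derivative h x) (at x within {x-1..x+1})"
    unfolding add_0 by (intro has_vector_derivative_transform[OF _ eq]) auto
  moreover have "x \<in> interior {x-1..x+1}" by simp
  ultimately show ?thesis by (simp only: at_within_interior)
qed

text \<open>Regularity: the bound state and its weak derivative are continuous, and the second
  derivative agrees almost everywhere with the continuous function (V - E) \<Phi>. Hence the
  equation holds classically.\<close>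

lemma bound_state_solves_ode:
  assumes "bound_state V E \<Phi>" and V: "continuous_on UNIV V"
  obtains \<Phi>' where "\<And>x. (\<Phi> has_vector_derivative \<Phi>' x) (at x)"
    "\<And>x. (\<Phi>' has_vector_derivative of_real (V x - E) * \<Phi> x) (at x)"
proof -
  obtain \<Phi>' \<Phi>'' where ac: "has_ac_derivative \<Phi> \<Phi>'" "has_ac_derivative \<Phi>' \<Phi>''"
    and AE: "AE x in lborel. complex_of_real E * \<Phi> x = - \<Phi>'' x + complex_of_real (V x) * \<Phi> x"
    using assms by (auto simp: bound_state_def schroedinger_def)
  note cont = has_ac_derivative_continuous[OF ac(1)] has_ac_derivative_continuous[OF ac(2)]
  show ?thesis
  proof (rule that)
    show "(\<Phi> has_vector_derivative \<Phi>' x) (at x)" for x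
      by (rule has_ac_derivative_C1[OF ac(1) cont(2)]) simp
    show "(\<Phi>' has_vector_derivative of_real (V x - E) * \<Phi> x) (at x)" for x
    proof (rule has_ac_derivative_C1[OF ac(2)])
      show "continuous_on UNIV (\<lambda>x. of_real (V x - E) * \<Phi> x)"
        by (intro continuous_intros cont V)
      show "AE x in lborel. \<Phi>'' x = of_real (V x - E) * \<Phi> x"
        using AE by eventually_elim (simp add: algebra_simps add_eq_0_iff)
    qed
  qed
qed

section \<open>A square integrable real solution with the prescribed initial data\<close>

lemma primitive_le_integral:
  assumes f: "continuous_on UNIV f" and le: "\<And>x. 0 \<le> f x" "\<And>x. f x \<le> g x"
    and g: "integrable lborel g" and "x \<ge> 0"
  shows "primitive f x \<le> integral\<^sup>L lborel g"
proof -
  have "primitive f x = (LINT t:{0..x}|lborel. f t)"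
    unfolding primitive_def using \<open>x \<ge> 0\<close> by (rule interval_integral_Icc)
  also have "\<dots> \<le> integral\<^sup>L lborel g"
    unfolding set_lebesgue_integral_def
  proof (rule integral_mono[OF _ g])
    show "integrable lborel (\<lambda>t. indicator {0..x} t *\<^sub>R f t)"
      using borel_integrable_atLeastAtMost'[OF continuous_on_subset[OF f]]
      by (simp add: set_integrable_def)
    show "indicator {0..x} t *\<^sub>R f t \<le> g t" for t
      using le[of t] by (auto simp: indicator_def)
  qed
  finally show ?thesis .
qed

lemma periodic_tail_bounded:
  fixes q :: "real \<Rightarrow> real"
  assumes q: "continuous_on UNIV q" and per: "\<And>x. x \<ge> a \<Longrightarrow> q (x + 1) = q x" and "a \<ge> 0"
  obtains K where "\<And>x. x \<ge> 0 \<Longrightarrow> \<bar>q x\<bar> \<le> K"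
proof -
  have "compact (q ` {0..a+1})"
    by (intro compact_continuous_image continuous_on_subset[OF q]) auto
  then obtain K where K: "\<And>x. x \<in> {0..a+1} \<Longrightarrow> \<bar>q x\<bar> \<le> K"
    by (fastforce dest!: compact_imp_bounded simp: bounded_iff)
  have "\<bar>q x\<bar> \<le> K" if "x \<ge> 0" for x
  proof (cases "x \<le> a")
    case True
    thus ?thesis using that K by simp
  next
    case False
    hence "a \<le> x" by simp
    thus ?thesis
      by (rule ge_unit_step_induct[rotated 2]) (use K \<open>a \<ge> 0\<close> per in auto)
  qed
  thus ?thesis by (rule that)
qed

text \<open>The coefficient q is real, so the real part solves the same equation, and the squared
  norm of the complex solution bounds the integral of its square.\<close>

lemma square_integrable_solution_Re:
  fixes \<Psi> \<Psi>' :: "real \<Rightarrow> complex" and q :: "real \<Rightarrow> real"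
  assumes q: "continuous_on UNIV q" "\<And>x. x \<ge> a \<Longrightarrow> q (x + 1) = q x" "a \<ge> 0"
    and \<Psi>: "\<And>x. (\<Psi> has_vector_derivative \<Psi>' x) (at x)"
    and \<Psi>': "\<And>x. (\<Psi>' has_vector_derivative q x * \<Psi> x) (at x)"
    and int: "integrable lborel (\<lambda>x. (cmod (\<Psi> x))\<^sup>2)"
    and "Re (\<Psi> 0) \<noteq> 0 \<or> Re (\<Psi>' 0) \<noteq> 0"
  obtains K B S where
    "square_integrable_solution q (\<lambda>x. Re (\<Psi> x)) (\<lambda>x. Re (\<Psi>' x)) a K B S"
proof -
  obtain K where K: "\<And>x. x \<ge> 0 \<Longrightarrow> \<bar>q x\<bar> \<le> K"
    using periodic_tail_bounded[OF q] by blast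
  define S where "S = primitive (\<lambda>x. (Re (\<Psi> x))\<^sup>2)"
  have Re: "((\<lambda>x. Re (f x)) has_real_derivative Re d) (at x)"
    if "(f has_vector_derivative d) (at x)" for f d x
    unfolding has_real_derivative_iff_has_vector_derivative
    using bounded_linear.has_vector_derivative[OF bounded_linear_Re that] .
  have "continuous_on UNIV \<Psi>"
    using \<Psi> by (auto simp: continuous_on_eq_continuous_at intro: has_vector_derivative_continuous)
  hence cont: "continuous_on UNIV (\<lambda>x. (Re (\<Psi> x))\<^sup>2)" by (intro continuous_intros)
  have "square_integrable_solution q (\<lambda>x. Re (\<Psi> x)) (\<lambda>x. Re (\<Psi>' x)) a K
      (integral\<^sup>L lborel (\<lambda>x. (cmod (\<Psi> x))\<^sup>2)) S"
  proof
    show "((\<lambda>x. Re (\<Psi> x)) has_real_derivative Re (\<Psi>' x)) (at x)" for x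
      by (rule Re[OF \<Psi>])
    show "((\<lambda>x. Re (\<Psi>' x)) has_real_derivative q x * Re (\<Psi> x)) (at x)" for x
      using Re[OF \<Psi>', of x] by simp
    show "(S has_real_derivative (Re (\<Psi> x))\<^sup>2) (at x)" for x
      unfolding S_def by (rule primitive_deriv[OF cont])
    show "S x \<le> (LINT x|lborel. (cmod (\<Psi> x))\<^sup>2)" if "0 \<le> x" for x
      unfolding S_def using that
      by (intro primitive_le_integral[OF cont _ _ int])
         (auto simp: abs_Re_le_cmod abs_le_square_iff[symmetric])
  qed (use assms K in auto)
  thus ?thesis by (rule that)
qed

lemma complex_ode_nonzero_data:
  fixes \<Psi> \<Psi>' :: "real \<Rightarrow> complex" and q :: "real \<Rightarrow> real"
  assumes q: "continuous_on UNIV q"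
    and \<Psi>: "\<And>x. (\<Psi> has_vector_derivative \<Psi>' x) (at x)"
    and \<Psi>': "\<And>x. (\<Psi>' has_vector_derivative q x * \<Psi> x) (at x)"
    and "\<Psi> x \<noteq> 0"
  shows "\<Psi> 0 \<noteq> 0 \<or> \<Psi>' 0 \<noteq> 0"
proof (rule ccontr)
  assume zero: "\<not> (\<Psi> 0 \<noteq> 0 \<or> \<Psi>' 0 \<noteq> 0)"
  define a b where "a = min x 0" and "b = max x 0"
  have "compact (q ` {a..b})"
    by (intro compact_continuous_image continuous_on_subset[OF q]) auto
  then obtain K where K: "\<And>y. y \<in> {a..b} \<Longrightarrow> \<bar>q y\<bar> \<le> K"
    by (fastforce dest!: compact_imp_bounded simp: bounded_iff)
  have "0 \<le> K" using K[of x] by (auto simp: a_def b_def)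
  have "\<Psi> x = 0 \<and> \<Psi>' x = 0"
  proof (rule ode_zero[where a = a and b = b and u = \<Psi> and u' = \<Psi>' and x = x
        and u'' = "\<lambda>x. q x * \<Psi> x" and K = K and ?x0.0 = 0])
    fix y assume "y \<in> {a..b}"
    show "(\<Psi> has_vector_derivative \<Psi>' y) (at y within {a..b})"
      "(\<Psi>' has_vector_derivative q y * \<Psi> y) (at y within {a..b})"
      using \<Psi> \<Psi>' by (auto intro: has_vector_derivative_at_within)
    show "norm (q y * \<Psi> y) \<le> K * norm (\<Psi> y)"
      using K[OF \<open>y \<in> {a..b}\<close>] by (auto simp: norm_mult intro: mult_right_mono)
  qed (use zero \<open>0 \<le> K\<close> in \<open>auto simp: a_def b_def\<close>)
  thus False using \<open>\<Psi> x \<noteq> 0\<close> by simp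
qed

lemma has_vector_derivative_reflect:
  assumes "\<And>x. (f has_vector_derivative f' x) (at x)"
  shows "((\<lambda>x. f (- x)) has_vector_derivative - f' (- x)) (at x)"
  using vector_diff_chain_at[of "\<lambda>x. - x" "-1" x f "f' (- x)"] assms[of "- x"]
    has_vector_derivative_minus[OF has_vector_derivative_id, of "at x"]
  by (simp add: o_def)

text \<open>The solution \<open>u\<close> of the initial value problem at \<open>z = E\<close> is a multiple of \<open>\<Phi>\<close> in the
  even case, and of the odd part of \<open>\<Phi>\<close> otherwise; either way it is square integrable.\<close>

lemma bound_state_solution:
  assumes V: "continuous_on UNIV V" "even_fun V"
    and per: "\<And>x. x \<ge> a \<Longrightarrow> V (x + 1) = V x" "a \<ge> 0"
    and bs: "bound_state V E \<Phi>"
  obtains u u' K B S where "square_integrable_solution (\<lambda>x. V x - E) u u' a K B S"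
    "if even_fun \<Phi> then u 0 = 1 \<and> u' 0 = 0 else u 0 = 0 \<and> u' 0 = 1"
proof -
  obtain \<Phi>' where \<Phi>: "\<And>x. (\<Phi> has_vector_derivative \<Phi>' x) (at x)"
    and \<Phi>': "\<And>x. (\<Phi>' has_vector_derivative of_real (V x - E) * \<Phi> x) (at x)"
    using bound_state_solves_ode[OF bs V(1)] by blast
  have q: "continuous_on UNIV (\<lambda>x. V x - E)" by (intro continuous_intros V)
  have per': "V (x + 1) - E = V x - E" if "x \<ge> a" for x
    using per(1)[OF that] by simp
  have int: "integrable lborel (\<lambda>x. (cmod (\<Phi> x))\<^sup>2)"
    and nz: "\<exists>x. \<Phi> x \<noteq> 0"
    using bs by (auto simp: bound_state_def schroedinger_def square_integrable_def)
  show ?thesis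
  proof (cases "even_fun \<Phi>")
    case True
    \<comment> \<open>By evenness both \<open>\<Phi>' 0\<close> and its negative are the derivative
      of \<Phi> at 0.\<close>
    have "\<Phi>' 0 = 0"
    proof -
      have "(\<Phi> has_vector_derivative - \<Phi>' (- 0)) (at 0)"
        using has_vector_derivative_reflect[OF \<Phi>, of 0] True by (simp add: even_fun_def)
      from vector_derivative_unique_at[OF this \<Phi>] show ?thesis by simp
    qed
    moreover have "\<Phi> 0 \<noteq> 0 \<or> \<Phi>' 0 \<noteq> 0"
      using nz complex_ode_nonzero_data[OF q \<Phi> \<Phi>'] by blast
    ultimately have "\<Phi> 0 \<noteq> 0" by simp
    define c where "c = 1 / \<Phi> 0"
    have ode: "((\<lambda>x. c * \<Phi> x) has_vector_derivative c * \<Phi>' x) (at x)"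
      "((\<lambda>x. c * \<Phi>' x) has_vector_derivative of_real (V x - E) * (c * \<Phi> x)) (at x)" for x
      using has_vector_derivative_mult_right[OF \<Phi>, of c] has_vector_derivative_mult_right[OF \<Phi>', of c]
      by (simp_all add: mult_ac)
    have int_c: "integrable lborel (\<lambda>x. (cmod (c * \<Phi> x))\<^sup>2)"
      using int by (simp add: norm_mult power_mult_distrib)
    have "c * \<Phi> 0 = 1" using \<open>\<Phi> 0 \<noteq> 0\<close> by (simp add: c_def)
    then obtain K B S where
      "square_integrable_solution (\<lambda>x. V x - E) (\<lambda>x. Re (c * \<Phi> x)) (\<lambda>x. Re (c * \<Phi>' x)) a K B S"
      using square_integrable_solution_Re[OF q per' per(2) ode int_c] by auto
    thus ?thesis
      by (rule that) (use True \<open>\<Phi>' 0 = 0\<close> \<open>\<Phi> 0 \<noteq> 0\<close> in \<open>auto simp: c_def\<close>)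
  next
    case False
    \<comment> \<open>Twice the odd part of \<Phi>, which solves the same equation because V is
      even. It is nonzero since \<Phi> is not even, and it vanishes at 0; so its derivative there is
      nonzero and division by it gives the data (0, 1).\<close>
    define \<Psi> \<Psi>' where "\<Psi> x = \<Phi> x - \<Phi> (- x)" and "\<Psi>' x = \<Phi>' x + \<Phi>' (- x)" for x
    have \<Psi>: "(\<Psi> has_vector_derivative \<Psi>' x) (at x)" for x
      unfolding \<Psi>_def \<Psi>'_def
      using has_vector_derivative_diff[OF \<Phi> has_vector_derivative_reflect[OF \<Phi>]] by simp
    have \<Psi>': "(\<Psi>' has_vector_derivative of_real (V x - E) * \<Psi> x) (at x)" for x
    proof -
      have "(\<Psi>' has_vector_derivative of_real (V x - E) * \<Phi> x + - (of_real (V (- x) - E) * \<Phi> (- x))) (at x)"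
        unfolding \<Psi>'_def by (intro has_vector_derivative_add has_vector_derivative_reflect \<Phi>')
      thus ?thesis using V(2) by (simp add: even_fun_def \<Psi>_def algebra_simps)
    qed
    obtain x where "\<Phi> (- x) \<noteq> \<Phi> x" using False by (auto simp: even_fun_def)
    hence "\<Psi> x \<noteq> 0" by (simp add: \<Psi>_def)
    hence "\<Psi> 0 \<noteq> 0 \<or> \<Psi>' 0 \<noteq> 0" by (rule complex_ode_nonzero_data[OF q \<Psi> \<Psi>'])
    hence "\<Psi>' 0 \<noteq> 0" by (simp add: \<Psi>_def)
    define c where "c = 1 / \<Psi>' 0"
    have ode: "((\<lambda>x. c * \<Psi> x) has_vector_derivative c * \<Psi>' x) (at x)"
      "((\<lambda>x. c * \<Psi>' x) has_vector_derivative of_real (V x - E) * (c * \<Psi> x)) (at x)" for x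
      using has_vector_derivative_mult_right[OF \<Psi>, of c] has_vector_derivative_mult_right[OF \<Psi>', of c]
      by (simp_all add: mult_ac)
    have int_c: "integrable lborel (\<lambda>x. (cmod (c * \<Psi> x))\<^sup>2)"
    proof -
      have "integrable lborel (\<lambda>x. 2 * (cmod (\<Phi> x))\<^sup>2 + 2 * (cmod (\<Phi> (- x)))\<^sup>2)"
        using int lborel_integrable_real_affine[OF int, of "-1" 0] by simp
      hence "integrable lborel (\<lambda>x. (cmod (\<Psi> x))\<^sup>2)"
      proof (rule Bochner_Integration.integrable_bound)
        have "continuous_on UNIV \<Psi>"
          using \<Psi> by (auto simp: continuous_on_eq_continuous_at intro: has_vector_derivative_continuous)
        hence "continuous_on UNIV (\<lambda>x. (cmod (\<Psi> x))\<^sup>2)" by (intro continuous_intros)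
        thus "(\<lambda>x. (cmod (\<Psi> x))\<^sup>2) \<in> borel_measurable lborel"
          using borel_measurable_continuous_onI by simp
        have "(cmod (\<Psi> x))\<^sup>2 \<le> 2 * (cmod (\<Phi> x))\<^sup>2 + 2 * (cmod (\<Phi> (- x)))\<^sup>2" for x
        proof -
          have "(cmod (\<Psi> x))\<^sup>2 \<le> (cmod (\<Phi> x) + cmod (\<Phi> (- x)))\<^sup>2"
            unfolding \<Psi>_def by (intro power_mono norm_triangle_ineq4) auto
          also have "\<dots> \<le> 2 * (cmod (\<Phi> x))\<^sup>2 + 2 * (cmod (\<Phi> (- x)))\<^sup>2"
            using sum_squares_bound[of "cmod (\<Phi> x)" "cmod (\<Phi> (- x))"] by (simp add: power2_sum)
          finally show ?thesis .
        qed
        thus "AE x in lborel. norm ((cmod (\<Psi> x))\<^sup>2) \<le> norm (2 * (cmod (\<Phi> x))\<^sup>2 + 2 * (cmod (\<Phi> (- x)))\<^sup>2)"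
          by simp
      qed
      thus ?thesis by (simp add: norm_mult power_mult_distrib)
    qed
    have "c * \<Psi>' 0 = 1" using \<open>\<Psi>' 0 \<noteq> 0\<close> by (simp add: c_def)
    then obtain K B S where
      "square_integrable_solution (\<lambda>x. V x - E) (\<lambda>x. Re (c * \<Psi> x)) (\<lambda>x. Re (c * \<Psi>' x)) a K B S"
      using square_integrable_solution_Re[OF q per' per(2) ode int_c] by auto
    thus ?thesis
      by (rule that) (use False \<open>\<Psi>' 0 \<noteq> 0\<close> in \<open>auto simp: c_def \<Psi>_def\<close>)
  qed
qed

theorem theorem2p1:
  fixes V V_per V_def :: "real \<Rightarrow> real" and \<rho> E :: real and \<Phi> :: "real \<Rightarrow> complex"
  assumes "smooth V"
    and "even_fun V"
    and "\<And>x. V x = V_per x + V_def x"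
    and "\<And>x. V_per (x + 1) = V_per x"
    and "\<rho> > 0"
    and "\<And>x. \<bar>x\<bar> > \<rho> \<Longrightarrow> V_def x = 0"
    and "bound_state V E \<Phi>"
    and "E > 0"
  shows "\<exists>k>0. \<exists>M\<^sub>0>\<rho>. \<exists>C. \<forall>M\<ge>M\<^sub>0.
           (\<exists>!z. Theta_root V \<Phi> E k M z) \<and>
           Theta V \<Phi> M field_differentiable (at (complex_of_real E)) \<and>
           deriv (Theta V \<Phi> M) (complex_of_real E) \<noteq> 0 \<and>
           (\<forall>z. Theta_root V \<Phi> E k M z \<longrightarrow>
              cmod (z - (complex_of_real E
                         - Theta V \<Phi> M (complex_of_real E)
                           / deriv (Theta V \<Phi> M) (complex_of_real E)))
                \<le> C * exp (- 4 * k * M))"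
proof -
  have "(deriv ^^ 0) V differentiable (at x)" for x
    using assms(1) unfolding smooth_def by blast
  hence cont: "continuous_on UNIV V"
    by (simp add: continuous_on_eq_continuous_at differentiable_imp_continuous_within)
  \<comment> \<open>From \<open>\<rho> + 1\<close> on, both x and x + 1 lie strictly outside the
    support of the defect, so V coincides with its periodic part at both points.\<close>
  have per: "V (x + 1) = V x" if "x \<ge> \<rho> + 1" for x
    using that assms(3)[of x] assms(3)[of "x + 1"] assms(4,5) assms(6)[of x] assms(6)[of "x + 1"] by simp
  obtain u u' K B S where sol: "square_integrable_solution (\<lambda>x. V x - E) u u' (\<rho> + 1) K B S"
    and init: "if even_fun \<Phi> then u 0 = 1 \<and> u' 0 = 0 else u 0 = 0 \<and> u' 0 = 1"
    using bound_state_solution[OF cont assms(2) per _ assms(7)] assms(5) by (metis add_nonneg_nonneg less_imp_le zero_le_one)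
  obtain w w' \<kappa> A where pair: "solution_pair (\<lambda>x. V x - E) u u' w w' \<kappa> A"
    using square_integrable_solution.ex_solution_pair[OF sol] by blast
  define k where "k = \<kappa> / 2"
  have "k > 0" using solution_pair.\<kappa>_pos[OF pair] by (simp add: k_def)
  obtain C N where C: "\<And>M. M \<ge> N \<Longrightarrow>
           (\<exists>!z. Theta_root V \<Phi> E k M z) \<and>
           Theta V \<Phi> M field_differentiable (at (complex_of_real E)) \<and>
           deriv (Theta V \<Phi> M) (complex_of_real E) \<noteq> 0 \<and>
           (\<forall>z. Theta_root V \<Phi> E k M z \<longrightarrow>
              cmod (z - (complex_of_real E
                         - Theta V \<Phi> M (complex_of_real E)
                           / deriv (Theta V \<Phi> M) (complex_of_real E)))
                \<le> C * exp (- 4 * k * M))"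
    using solution_pair.Theta_root_asymptotics[OF pair refl assms(8) init]
    unfolding k_def[symmetric] eventually_at_top_linorder by blast
  show ?thesis
  proof (intro exI conjI allI impI)
    show "k > 0" by fact
    show "max N (\<rho> + 1) > \<rho>" by simp
  qed (use C in auto)
qed

end
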